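(* Consider the hierarchical Bayesian linear regression model described in the context, with a fixed number $p$ of potential predictors and a sequence of design matrices $\mathbf{X}=\mathbf{X}^{(n)}\in\mathbb{R}^{n\times p}$. Suppose the data are generated by the true model $M_{\mathcal{A}}$, i.e. $\mathbf{y}=\mathbf{X}_{\mathcal{A}}\boldsymbol\beta_{\mathcal{A}}+\boldsymbol\varepsilon$ with $\boldsymbol\varepsilon\sim\mathcal{N}(\mathbf{0},\sigma^2\mathrm{I}_n)$, for some nonempty $\mathcal{A}\subseteq\{1,\dots,p\}$, a coefficient vector $\boldsymbol\beta_{\mathcal{A}}$ and $\sigma^2>0$. Assume that for every nonempty $\mathcal{A}'\subseteq\{1,\dots,p\}$ such that $\mathcal{A}\not\subseteq\mathcal{A}'$ (i.e. $M_{\mathcal{A}'}$ does not nest $M_{\mathcal{A}}$), $$\lim_{n\to\infty}\frac{\boldsymbol\beta_{\mathcal{A}}^T\mathbf{X}_{\mathcal{A}}^T\big(\mathrm{I}_n-\mathbf{X}_{\mathcal{A}'}(\mathbf{X}_{\mathcal{A}'}^T\mathbf{X}_{\mathcal{A}'})^{-1}\mathbf{X}_{\mathcal{A}'}^T\big)\mathbf{X}_{\mathcal{A}}\boldsymbol\beta_{\mathcal{A}}}{n}=b_{\mathcal{A}'}\in(0,\infty).$$ Then the model is consistent in terms of model selection: $$\operatorname*{p\,lim}_{n\to\infty} p(M_{\mathcal{A}}\mid\mathbf{y},\mathbf{X})=1\quad\text{and}\quad \operatorname*{p\,lim}_{n\to\infty} p(M_{\mathcal{A}'}\mid\mathbf{y},\mathbf{X})=0\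 \text{ for all nonempty }\mathcal{A}'\neq\mathcal{A},$$ where the probability limits are taken with respect to the true sampling distribution $\mathbf{y}=\mathbf{X}_{\mathcal{A}}\boldsymbol\beta_{\mathcal{A}}+\boldsymbol\varepsilon$.
   Context: Setting: linear regression $\mathbf{y}=\mathbf{X}\boldsymbol\beta+\boldsymbol\varepsilon$ with $n$-dimensional zero-centered response $\mathbf{y}$, design matrix $\mathbf{X}=(\mathbf{x}_1,\dots,\mathbf{x}_p)\in\mathbb{R}^{n\times p}$ whose columns are zero-centered with $\|\mathbf{x}_j\|^2=n-1$, and it is assumed that no predictor is an exact linear combination of the other predictors. For $\mathcal{A}\subseteq\{1,\dots,p\}$, $\mathbf{X}_{\mathcal{A}}$ is the submatrix of columns with indices in $\mathcal{A}$, $\boldsymbol\beta_{\mathcal{A}}$ the corresponding coefficients, $\boldsymbol\beta_{\mathcal{A}^C}$ the remaining ones, and $k=|\mathcal{A}|$; the model $M_{\mathcal{A}}$ is the one in which exactly the coefficients with indices in $\mathcal{A}$ may be nonzero (it is identified with $\mathcal{A}$, so $p(M_{\mathcal{A}}\mid\mathbf{y},\mathbf{X})=p(\mathcal{A}\mid\mathbf{y},\mathbf{X})$). The hierarchical model is: $\mathbf{y}\mid\mathbf{X},\boldsymbol\beta,\sigma^2\sim\mathcal{N}(\mathbf{X}\boldsymbol\beta,\sigma^2\mathrm{I}_n)$; $p(\boldsymbol\beta\mid\mathcal{A},g,\sigma^2,\mathbf{X}_{\mathcal{A}})\propto\exp\!\big(-\tfrac12\boldsymbol\beta_{\mathcal{A}}^T(g^{-1}\sigma^{-2}\mathbf{X}_{\mathcal{A}}^T\mathbf{X}_{\mathcal{A}}+\lambda\mathrm{I}_k)\boldsymbol\beta_{\mathcal{A}}\big)\,h(\boldsymbol\beta_{\mathcal{A}^C})$,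 where $h(\boldsymbol\beta_{\mathcal{A}^C})=1$ if $\boldsymbol\beta_{\mathcal{A}^C}=\mathbf{0}$ and $0$ otherwise, and $\lambda=\max(1/k,1/300)$ if $n\le\zeta$ and $\lambda=0$ if $n>\zeta$, for a fixed sufficiently large constant $\zeta$; the random nonempty set $\mathcal{A}=\{\alpha_1,\dots,\alpha_k\}\subseteq\{1,\dots,p\}$ has prior $p(\mathcal{A})\propto(p_{\alpha_1}+\dots+p_{\alpha_k})\frac1k\tilde p(k)$, where $p_1,\dots,p_p\ge0$ with $\sum_i p_i=1$ and $\tilde p:\{1,\dots,p\}\to[0,\infty)$ are fixed hyperparameters (not depending on $n$); $g\sim\mathrm{IG}(1/2,n/2)$ (inverse gamma, shape $1/2$, scale $n/2$); $\sigma^2\sim\mathrm{IG}(a,b)$ with fixed $a,b>0$. $\operatorname{p\,lim}$ denotes limit in probability.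
   Formalization: The formal theorem adds the assumption that the true model has positive prior weight, (sum of p_i over i in A)·p̃(k)/k > 0; without it the posterior of M_A is 0 (or undefined) for every n and the claim fails. *)

theory Defs
  imports "HOL-Probability.Probability"
          "Jordan_Normal_Form.DL_Submatrix"
          "Jordan_Normal_Form.Gauss_Jordan_Elimination"
begin

(* Conventions: predictors are indexed 0..p-1 (column j of the JNF matrix X is x_{j+1});
   a model is a nonempty set A \<subseteq> {..<p}; X_A = submatrix X UNIV A (columns of A in increasing order);
   vectors beta_A are JNF vectors of dimension card A (entry i belongs to predictor pick A i). *)

definition design_cols :: "real mat \<Rightarrow> nat set \<Rightarrow> real mat" where
  "design_cols X A = submatrix X UNIV A"

definition IG_density :: "real \<Rightarrow> real \<Rightarrow> real \<Rightarrow> real" where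
  "IG_density al be x = (if 0 < x then be powr al / Gamma al * x powr (- al - 1) * exp (- be / x) else 0)"

definition ridge_lambda :: "real \<Rightarrow> nat \<Rightarrow> nat \<Rightarrow> real" where
  "ridge_lambda zeta n k = (if real n \<le> zeta then max (1 / real k) (1 / 300) else 0)"

definition prior_precision :: "real \<Rightarrow> real mat \<Rightarrow> nat set \<Rightarrow> real \<Rightarrow> real \<Rightarrow> real mat" where
  "prior_precision zeta X A g s2 =
     (let XA = design_cols X A; k = card A in
      (1 / (g * s2)) \<cdot>\<^sub>m (transpose_mat XA * XA)
        + ridge_lambda zeta (dim_row X) k \<cdot>\<^sub>m 1\<^sub>m k)"

definition prior_kernel :: "real \<Rightarrow> real mat \<Rightarrow> nat set \<Rightarrow> real \<Rightarrow> real \<Rightarrow> (nat \<Rightarrow> real) \<Rightarrow> real" where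
  "prior_kernel zeta X A g s2 b =
     (let v = vec (card A) b in exp (- (1/2) * (v \<bullet> (prior_precision zeta X A g s2 *\<^sub>v v))))"

definition coef_space :: "nat set \<Rightarrow> (nat \<Rightarrow> real) measure" where
  "coef_space A = PiM {..<card A} (\<lambda>_. lborel)"

definition prior_density :: "real \<Rightarrow> real mat \<Rightarrow> nat set \<Rightarrow> real \<Rightarrow> real \<Rightarrow> (nat \<Rightarrow> real) \<Rightarrow> real" where
  "prior_density zeta X A g s2 b =
     prior_kernel zeta X A g s2 b
       / enn2real (\<integral>\<^sup>+ c. ennreal (prior_kernel zeta X A g s2 c) \<partial>coef_space A)"

definition likelihood :: "real mat \<Rightarrow> nat set \<Rightarrow> real vec \<Rightarrow> real \<Rightarrow> (nat \<Rightarrow> real) \<Rightarrow> real" where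
  "likelihood X A y s2 b =
     (let r = y - design_cols X A *\<^sub>v vec (card A) b in
      (2 * pi * s2) powr (- real (dim_row X) / 2) * exp (- (r \<bullet> r) / (2 * s2)))"

definition marginal_lik :: "real \<Rightarrow> real \<Rightarrow> real \<Rightarrow> real mat \<Rightarrow> nat set \<Rightarrow> real vec \<Rightarrow> real" where
  "marginal_lik a b zeta X A y = enn2real
     (\<integral>\<^sup>+ g. \<integral>\<^sup>+ s2. \<integral>\<^sup>+ c.
        ennreal (likelihood X A y s2 c * prior_density zeta X A g s2 c
                 * IG_density (1/2) (real (dim_row X) / 2) g * IG_density a b s2)
        \<partial>coef_space A \<partial>lborel \<partial>lborel)"

definition model_weight :: "(nat \<Rightarrow> real) \<Rightarrow> (nat \<Rightarrow> real) \<Rightarrow> nat set \<Rightarrow> real" where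
  "model_weight pw pt A = (\<Sum>i\<in>A. pw i) / real (card A) * pt (card A)"

definition models :: "nat \<Rightarrow> nat set set" where
  "models p = {A. A \<subseteq> {..<p} \<and> A \<noteq> {}}"

definition post_model :: "nat \<Rightarrow> (nat \<Rightarrow> real) \<Rightarrow> (nat \<Rightarrow> real) \<Rightarrow> real \<Rightarrow> real \<Rightarrow> real
                          \<Rightarrow> real mat \<Rightarrow> real vec \<Rightarrow> nat set \<Rightarrow> real" where
  "post_model p pw pt a b zeta X y A =
     model_weight pw pt A * marginal_lik a b zeta X A y
       / (\<Sum>A'\<in>models p. model_weight pw pt A' * marginal_lik a b zeta X A' y)"

definition hat_mat :: "real mat \<Rightarrow> nat set \<Rightarrow> real mat" where
  "hat_mat X A = (let XA = design_cols X A in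
      XA * the (mat_inverse (transpose_mat XA * XA)) * transpose_mat XA)"

definition valid_design :: "nat \<Rightarrow> nat \<Rightarrow> real mat \<Rightarrow> bool" where
  "valid_design n p X \<longleftrightarrow> X \<in> carrier_mat n p
     \<and> (\<forall>j<p. (\<Sum>r<n. X $$ (r, j)) = 0 \<and> col X j \<bullet> col X j = real n - 1)
     \<and> (\<forall>j<p. \<forall>c. c \<in> carrier_vec p \<and> c $ j = 0 \<longrightarrow> col X j \<noteq> X *\<^sub>v c)"

(* convergence in (outer) probability of Z n to the constant c under the measures P n *)
definition conv_in_prob :: "(nat \<Rightarrow> 'a measure) \<Rightarrow> (nat \<Rightarrow> 'a \<Rightarrow> real) \<Rightarrow> real \<Rightarrow> bool" where
  "conv_in_prob P Z c \<longleftrightarrow> (\<forall>e>0. \<exists>B. (\<forall>n. B n \<in> sets (P n) \<and> {y \<in> space (P n). e < \<bar>Z n y - c\<bar>} \<subseteq> B n)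
       \<and> (\<lambda>n. measure (P n) (B n)) \<longlonglongrightarrow> 0)"

definition true_dist :: "real mat \<Rightarrow> nat set \<Rightarrow> real vec \<Rightarrow> real \<Rightarrow> (nat \<Rightarrow> real) measure" where
  "true_dist X A betaA s2 =
     PiM {..<dim_row X} (\<lambda>r. density lborel (normal_density ((design_cols X A *\<^sub>v betaA) $ r) (sqrt s2)))"

end

(*
  For n > zeta the ridge term vanishes. Completing the square in the coefficients and integrating out sigma^2
  gives, up to a factor that does not depend on the model A with k = |A| predictors,
     m_A(y) = int (1 + g)^(-k/2) (b + (R_A + S_A / (1 + g)) / 2)^(-(a + n/2)) IG(1/2, n/2)(dg),
  where R_A and S_A are the residual and the explained sums of squares. The prior puts g at scale n, so m_A is of the
  order n^(-k/2) (b + (R_A + O(S_A / n)) / 2)^(-(a + n/2)), in both directions and uniformly in y.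

  Let A be the true model, mu its mean vector, e the noise and P' the projection onto the columns of A'. Then
  R_A <= |e|^2 and R_A' = |d|^2 + 2 d.e + |e|^2 - |P' e|^2 with d = (I - P') mu. By Chebyshev and Markov, with
  probability tending to 1: |e|^2 / n is close to sigma^2, |P' e|^2 <= sqrt (ln n), and d.e = o(n).
  If A' does not contain A, then |d|^2 / n has a positive limit and the ratio m_A' / m_A decays exponentially.
  If A' strictly contains A, then d = 0, the ratio of the sums of squares to the power a + n/2 is at most
  exp (c sqrt (ln n)), and the factor n^((k - k') / 2) sends m_A' / m_A to 0.
*)
theory Submission
  imports Defs "Jordan_Normal_Form.Determinant" "HOL-Real_Asymp.Real_Asymp"
begin

section \<open>Projections onto column spaces\<close>

(* From here on the bullet is the scalar product of Jordan_Normal_Form only. *)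
no_notation inner (infix "\<bullet>" 70)

text \<open>The two comparisons have very different margins. Against a model that misses a true
  predictor the gain is exponential, so errors of a small multiple of n are affordable. This is
  attainable because the same |e|^2 occurs above and below the fraction line, so that only bounded
  terms and |P' e|^2 remain. Markov's inequality (the mean of |P' e|^2 is sigma^2 times the trace k'
  of P') needs a threshold tending to infinity, the power of n needs one that is o(ln n); sqrt (ln
  n) is both. The term S_A / (1 + g) stays bounded for g of order n because the normalisation of the
  columns gives |mu|^2 = O(n). The evidence is bounded below by the term of the true model alone, so
  each wrong model is controlled by a single ratio; the true model follows since the probabilities
  sum to 1. Off an exceptional event every estimate is deterministic in |e|^2, |P' e|^2 and d.e, and
  that event is the covering set which \<open>conv_in_prob\<close> asks for.\<close>

definition full_col_rank :: "real mat \<Rightarrow> bool" where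
  "full_col_rank M \<longleftrightarrow> (\<forall>v\<in>carrier_vec (dim_col M). M *\<^sub>v v = 0\<^sub>v (dim_row M) \<longrightarrow> v = 0\<^sub>v (dim_col M))"

text \<open>\<open>hat_mat\<close> for an arbitrary matrix, so that the projector algebra can be
  done without submatrices. The value of \<open>the\<close> is meaningful once
  \<open>gram_inverse\<close> applies.\<close>

definition col_proj :: "real mat \<Rightarrow> real mat" where
  "col_proj M = M * the (mat_inverse (transpose_mat M * M)) * transpose_mat M"

lemma hat_mat_eq_col_proj: "hat_mat X A = col_proj (design_cols X A)"
  by (simp add: hat_mat_def col_proj_def Let_def)

lemma scalar_prod_self_sum:
  fixes v :: "real vec"
  shows "v \<bullet> v = (\<Sum>i<dim_vec v. (v $ i)\<^sup>2)"
  by (simp add: scalar_prod_def power2_eq_square atLeast0LessThan)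

lemma scalar_prod_self_nonneg: "0 \<le> v \<bullet> (v :: real vec)"
  by (simp add: scalar_prod_self_sum sum_nonneg)

lemma scalar_prod_self_eq_0:
  fixes v :: "real vec"
  assumes "v \<in> carrier_vec n" "v \<bullet> v = 0"
  shows "v = 0\<^sub>v n"
proof -
  have "\<forall>i\<in>{..<dim_vec v}. (v $ i)\<^sup>2 = 0"
    using assms(2) unfolding scalar_prod_self_sum by (subst (asm) sum_nonneg_eq_0_iff) auto
  then show ?thesis using assms(1) by (intro eq_vecI) auto
qed

text \<open>If the Gram matrix kills v, then |M v|^2 = v . (M^T M v) = 0, so M v = 0 and injectivity
  of M forces v = 0.\<close>

lemma gram_inverse:
  assumes M: "M \<in> carrier_mat n k" and fr: "full_col_rank M"
  obtains G' where "the (mat_inverse (transpose_mat M * M)) = G'" "G' \<in> carrier_mat k k"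
    "(transpose_mat M * M) * G' = 1\<^sub>m k" "G' * (transpose_mat M * M) = 1\<^sub>m k"
proof -
  let ?G = "transpose_mat M * M"
  have Mt: "transpose_mat M \<in> carrier_mat k n" using M by simp
  have G: "?G \<in> carrier_mat k k" using M by auto
  have "Determinant.det ?G \<noteq> 0"
  proof
    assume "Determinant.det ?G = 0"
    then obtain v where v: "v \<in> carrier_vec k" "v \<noteq> 0\<^sub>v k" "?G *\<^sub>v v = 0\<^sub>v k"
      using det_0_iff_vec_prod_zero_field[OF G] by auto
    have Mv: "M *\<^sub>v v \<in> carrier_vec n" using M v by simp
    have "(M *\<^sub>v v) \<bullet> (M *\<^sub>v v) = (transpose_mat M *\<^sub>v (M *\<^sub>v v)) \<bullet> v"
      using transpose_vec_mult_scalar[OF M v(1) Mv] by simp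
    also have "transpose_mat M *\<^sub>v (M *\<^sub>v v) = 0\<^sub>v k"
      using v(3) assoc_mult_mat_vec[OF Mt M v(1)] by simp
    finally have "(M *\<^sub>v v) \<bullet> (M *\<^sub>v v) = 0" using v by simp
    then have "M *\<^sub>v v = 0\<^sub>v n" using Mv scalar_prod_self_eq_0 by blast
    then show False using fr v M unfolding full_col_rank_def by auto
  qed
  then have "?G \<in> Units (ring_mat TYPE(real) k b)"
    for b using det_non_zero_imp_unit[OF G] by simp
  then have "mat_inverse ?G \<noteq> None" using mat_inverse(1)[OF G] by metis
  then obtain G' where "mat_inverse ?G = Some G'" by auto
  then show ?thesis using that mat_inverse(2)[OF G] by auto
qed

locale full_rank_mat =
  fixes M :: "real mat" and n k :: nat
  assumes M[simp]: "M \<in> carrier_mat n k" and full_rank: "full_col_rank M"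
begin

definition Gi :: "real mat" where "Gi = the (mat_inverse (transpose_mat M * M))"

lemma Mt[simp]: "transpose_mat M \<in> carrier_mat k n" by simp

lemma dims[simp]: "dim_row M = n" "dim_col M = k"
  using carrier_matD[OF M] by auto

lemma mult_vec_carrier[simp]: "v \<in> carrier_vec k \<Longrightarrow> M *\<^sub>v v \<in> carrier_vec n"
  by (rule mult_mat_vec_carrier[OF M])

lemma Gi: "Gi \<in> carrier_mat k k" "(transpose_mat M * M) * Gi = 1\<^sub>m k" "Gi * (transpose_mat M * M) = 1\<^sub>m k"
  using gram_inverse[OF M full_rank] unfolding Gi_def by metis+

text \<open>The Gram matrix is symmetric, so the transpose of its inverse is again a left inverse of
  it, and inverses are unique.\<close>

lemma Gi_sym: "transpose_mat Gi = Gi"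
proof -
  let ?G = "transpose_mat M * M"
  have G: "?G \<in> carrier_mat k k" by (rule mult_carrier_mat[OF Mt M])
  have "transpose_mat ?G = ?G" using transpose_mult[OF Mt M] by simp
  then have "transpose_mat Gi * ?G = 1\<^sub>m k"
    using transpose_mult[OF G Gi(1)] Gi(2) by simp
  then have "transpose_mat Gi * ?G * Gi = Gi" using Gi(1) by simp
  moreover have "transpose_mat Gi * ?G * Gi = transpose_mat Gi * (?G * Gi)"
    by (rule assoc_mult_mat[of _ k k _ k _ k]) (use Gi G in auto)
  ultimately show ?thesis using Gi by simp
qed

lemma col_proj_eq: "col_proj M = M * Gi * transpose_mat M"
  by (simp add: col_proj_def Gi_def)

lemma col_proj_carrier[simp]: "col_proj M \<in> carrier_mat n n"
  unfolding col_proj_eq using M Gi(1) by (metis mult_carrier_mat Mt)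

lemma col_proj_sym: "transpose_mat (col_proj M) = col_proj M"
proof -
  have MG: "M * Gi \<in> carrier_mat n k" using M Gi(1) by (rule mult_carrier_mat)
  have "transpose_mat (col_proj M) = M * (Gi * transpose_mat M)"
    unfolding col_proj_eq transpose_mult[OF MG Mt] transpose_mult[OF M Gi(1)] Gi_sym by simp
  also have "\<dots> = col_proj M" unfolding col_proj_eq
    by (rule assoc_mult_mat[symmetric, of _ n k _ k _ n]) (use Gi in auto)
  finally show ?thesis .
qed

lemma col_proj_mult: "col_proj M * M = M"
proof -
  have MG: "M * Gi \<in> carrier_mat n k" using M Gi(1) by (rule mult_carrier_mat)
  have G: "transpose_mat M * M \<in> carrier_mat k k" by (rule mult_carrier_mat[OF Mt M])
  have "col_proj M * M = M * Gi * (transpose_mat M * M)"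
    unfolding col_proj_eq by (rule assoc_mult_mat[OF MG Mt M])
  also have "\<dots> = M * (Gi * (transpose_mat M * M))" by (rule assoc_mult_mat[OF M Gi(1) G])
  finally show ?thesis using Gi by simp
qed

lemma col_proj_idem: "col_proj M * col_proj M = col_proj M"
proof -
  have GM: "Gi * transpose_mat M \<in> carrier_mat k n" by (rule mult_carrier_mat[OF Gi(1) Mt])
  have e: "col_proj M = M * (Gi * transpose_mat M)" unfolding col_proj_eq
    by (rule assoc_mult_mat[OF M Gi(1) Mt])
  have "col_proj M * (M * (Gi * transpose_mat M)) = (col_proj M * M) * (Gi * transpose_mat M)"
    by (rule assoc_mult_mat[symmetric, OF col_proj_carrier M GM])
  then show ?thesis using e col_proj_mult by simp
qed

text \<open>The ordinary least squares coefficients of the regression of \<open>y\<close> on the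
  columns of \<open>M\<close>.\<close>

definition lsq :: "real vec \<Rightarrow> real vec" where
  "lsq y = (Gi * transpose_mat M) *\<^sub>v y"

lemma lsq_carrier[simp]: "y \<in> carrier_vec n \<Longrightarrow> lsq y \<in> carrier_vec k"
  unfolding lsq_def using mult_carrier_mat[OF Gi(1) Mt] by simp

lemma col_proj_vec: "y \<in> carrier_vec n \<Longrightarrow> col_proj M *\<^sub>v y = M *\<^sub>v lsq y"
  unfolding lsq_def col_proj_eq assoc_mult_mat[OF M Gi(1) Mt]
  by (rule assoc_mult_mat_vec[OF M mult_carrier_mat[OF Gi(1) Mt]])

lemma lsq_mult: "v \<in> carrier_vec k \<Longrightarrow> lsq (M *\<^sub>v v) = v"
proof -
  assume v: "v \<in> carrier_vec k"
  have "lsq (M *\<^sub>v v) = (Gi * transpose_mat M * M) *\<^sub>v v"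
    unfolding lsq_def using assoc_mult_mat_vec[OF mult_carrier_mat[OF Gi(1) Mt] M v] by simp
  also have "Gi * transpose_mat M * M = 1\<^sub>m k"
    using assoc_mult_mat[OF Gi(1) Mt M] Gi by simp
  finally show ?thesis using v by simp
qed

lemma col_proj_fix: "v \<in> carrier_vec k \<Longrightarrow> col_proj M *\<^sub>v (M *\<^sub>v v) = M *\<^sub>v v"
  using col_proj_vec[of "M *\<^sub>v v"] lsq_mult mult_vec_carrier by simp

lemma col_proj_vec_carrier[simp]: "y \<in> carrier_vec n \<Longrightarrow> col_proj M *\<^sub>v y \<in> carrier_vec n"
  by (rule mult_mat_vec_carrier[OF col_proj_carrier])

lemma col_proj_self_adjoint:
  assumes "x \<in> carrier_vec n" "y \<in> carrier_vec n"
  shows "(col_proj M *\<^sub>v x) \<bullet> y = x \<bullet> (col_proj M *\<^sub>v y)"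
  using transpose_vec_mult_scalar[OF col_proj_carrier assms(2) assms(1)] col_proj_sym by simp

lemma col_proj_twice:
  "y \<in> carrier_vec n \<Longrightarrow> col_proj M *\<^sub>v (col_proj M *\<^sub>v y) = col_proj M *\<^sub>v y"
  using col_proj_vec col_proj_fix by simp

lemma col_proj_residual_orth:
  assumes "y \<in> carrier_vec n" "v \<in> carrier_vec k"
  shows "(y - col_proj M *\<^sub>v y) \<bullet> (M *\<^sub>v v) = 0"
proof -
  have Mv: "M *\<^sub>v v \<in> carrier_vec n" using assms by simp
  have "(y - col_proj M *\<^sub>v y) \<bullet> (M *\<^sub>v v) = y \<bullet> (M *\<^sub>v v) - (col_proj M *\<^sub>v y) \<bullet> (M *\<^sub>v v)"
    by (rule minus_scalar_prod_distrib[of _ n]) (use assms Mv in auto)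
  also have "(col_proj M *\<^sub>v y) \<bullet> (M *\<^sub>v v) = y \<bullet> (M *\<^sub>v v)"
    using col_proj_self_adjoint[OF assms(1) Mv] col_proj_fix[OF assms(2)] by simp
  finally show ?thesis by simp
qed

definition rss :: "real vec \<Rightarrow> real" where
  "rss y = (y - col_proj M *\<^sub>v y) \<bullet> (y - col_proj M *\<^sub>v y)"

definition ess :: "real vec \<Rightarrow> real" where
  "ess y = (col_proj M *\<^sub>v y) \<bullet> (col_proj M *\<^sub>v y)"

lemma rss_nonneg: "0 \<le> rss y" and ess_nonneg: "0 \<le> ess y"
  unfolding rss_def ess_def by (rule scalar_prod_self_nonneg)+

lemma ess_eq: "y \<in> carrier_vec n \<Longrightarrow> ess y = y \<bullet> (col_proj M *\<^sub>v y)"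
  unfolding ess_def using col_proj_self_adjoint[of y "col_proj M *\<^sub>v y"] col_proj_twice by simp

lemma rss_eq: "y \<in> carrier_vec n \<Longrightarrow> rss y = y \<bullet> y - ess y"
proof -
  assume y: "y \<in> carrier_vec n"
  let ?P = "col_proj M *\<^sub>v y"
  have P: "?P \<in> carrier_vec n" using y by simp
  have "rss y = (y - ?P) \<bullet> y - (y - ?P) \<bullet> ?P"
    unfolding rss_def by (rule scalar_prod_minus_distrib[of _ n]) (use y P in auto)
  also have "(y - ?P) \<bullet> ?P = 0"
    using col_proj_residual_orth[OF y, of "lsq y"] y col_proj_vec by simp
  also have "(y - ?P) \<bullet> y = y \<bullet> y - ?P \<bullet> y"
    by (rule minus_scalar_prod_distrib[of _ n]) (use y P in auto)
  also have "?P \<bullet> y = ess y" using comm_scalar_prod[OF P y] ess_eq[OF y] by simp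
  finally show ?thesis by simp
qed

text \<open>For a symmetric idempotent matrix the sum of the squared entries is the trace. With P =
  M N and N the left inverse of M, the trace of M N equals the trace of N M, which is the identity
  of size k. This gives the expected size of the projected noise.\<close>

lemma col_proj_entries_sq_sum: "(\<Sum>i<n. \<Sum>j<n. (col_proj M $$ (i,j))\<^sup>2) = real k"
proof -
  let ?P = "col_proj M"
  let ?N = "Gi * transpose_mat M"
  have dP: "dim_row ?P = n" "dim_col ?P = n" using carrier_matD[OF col_proj_carrier] by auto
  have N: "?N \<in> carrier_mat k n" by (rule mult_carrier_mat[OF Gi(1) Mt])
  then have dN: "dim_row ?N = k" "dim_col ?N = n" by auto
  have sym: "?P $$ (j,i) = ?P $$ (i,j)" if "i < n" "j < n" for i j
    using col_proj_sym dP that by (metis index_transpose_mat(1))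
  have "(\<Sum>j<n. (?P $$ (i,j))\<^sup>2) = ?P $$ (i,i)" if i: "i < n" for i
  proof -
    have "?P $$ (i,i) = (?P * ?P) $$ (i,i)" by (simp add: col_proj_idem)
    also have "\<dots> = (\<Sum>j<n. ?P $$ (i,j) * ?P $$ (j,i))"
      using i dP by (simp add: scalar_prod_def atLeast0LessThan)
    also have "\<dots> = (\<Sum>j<n. (?P $$ (i,j))\<^sup>2)"
      by (rule sum.cong) (use i sym in \<open>auto simp: power2_eq_square\<close>)
    finally show ?thesis by simp
  qed
  then have "(\<Sum>i<n. \<Sum>j<n. (?P $$ (i,j))\<^sup>2) = (\<Sum>i<n. ?P $$ (i,i))" by simp
  also have "\<dots> = (\<Sum>i<n. \<Sum>l<k. M $$ (i,l) * ?N $$ (l,i))"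
  proof (rule sum.cong, simp)
    fix i assume "i \<in> {..<n}"
    then have i: "i < n" by simp
    have "?P = M * ?N" unfolding col_proj_eq by (rule assoc_mult_mat[OF M Gi(1) Mt])
    moreover have "(M * ?N) $$ (i,i) = (\<Sum>l<k. M $$ (i,l) * ?N $$ (l,i))"
      using i dN by (simp add: times_mat_def scalar_prod_def atLeast0LessThan del: index_mult_mat)
    ultimately show "?P $$ (i,i) = (\<Sum>l<k. M $$ (i,l) * ?N $$ (l,i))" by simp
  qed
  also have "\<dots> = (\<Sum>l<k. \<Sum>i<n. ?N $$ (l,i) * M $$ (i,l))"
    by (subst sum.swap) (simp add: mult.commute)
  also have "\<dots> = (\<Sum>l<k. (?N * M) $$ (l,l))"
    using dN by (intro sum.cong) (auto simp: times_mat_def scalar_prod_def atLeast0LessThan simp del: index_mult_mat)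
  also have "?N * M = 1\<^sub>m k" using assoc_mult_mat[OF Gi(1) Mt M] Gi by simp
  finally show ?thesis by simp
qed

text \<open>The residual of \<open>y\<close> is orthogonal to the column space, so it splits off and
  leaves a quadratic in the fitted vectors \<open>M c\<close> and \<open>P y\<close>. Its minimum
  over \<open>c\<close> is the least squares solution shrunk by \<open>g / (1 + g)\<close>, the
  posterior centre under a g-prior.\<close>

lemma complete_square:
  assumes y: "y \<in> carrier_vec n" and c: "c \<in> carrier_vec k" and g: "0 < g"
  defines "w \<equiv> M *\<^sub>v (c - (g / (1 + g)) \<cdot>\<^sub>v lsq y)"
  shows "(y - M *\<^sub>v c) \<bullet> (y - M *\<^sub>v c) + (M *\<^sub>v c) \<bullet> (M *\<^sub>v c) / g
    = rss y + ess y / (1 + g) + (1 + 1 / g) * (w \<bullet> w)"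
proof -
  let ?t = "g / (1 + g)"
  let ?u = "M *\<^sub>v lsq y" and ?v = "M *\<^sub>v c" and ?e = "y - col_proj M *\<^sub>v y"
  have l: "lsq y \<in> carrier_vec k" using y by simp
  have u: "?u \<in> carrier_vec n" and v: "?v \<in> carrier_vec n" and e: "?e \<in> carrier_vec n"
    using l c y by auto
  have Pu: "col_proj M *\<^sub>v y = ?u" using y by (rule col_proj_vec)
  have yv: "y - ?v = ?e + (?u - ?v)" unfolding Pu using y u v by (intro eq_vecI) auto
  have eu: "?e \<bullet> ?u = 0" and ev: "?e \<bullet> ?v = 0"
    using col_proj_residual_orth[OF y] l c by auto
  have w: "w = ?v - ?t \<cdot>\<^sub>v ?u" unfolding w_def
    using mult_minus_distrib_mat_vec[OF M c, of "?t \<cdot>\<^sub>v lsq y"] mult_mat_vec[OF M l] l by simp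
  have ue: "?u \<bullet> ?e = 0" and ve: "?v \<bullet> ?e = 0" and vu: "?v \<bullet> ?u = ?u \<bullet> ?v"
    using eu ev comm_scalar_prod[OF u e] comm_scalar_prod[OF v e] comm_scalar_prod[OF u v] by auto
  have "(y - ?v) \<bullet> (y - ?v) = (?e + (?u - ?v)) \<bullet> ?e + (?e + (?u - ?v)) \<bullet> (?u - ?v)"
    unfolding yv by (rule scalar_prod_add_distrib[of _ n]) (use e u v in auto)
  also have "(?e + (?u - ?v)) \<bullet> ?e = ?e \<bullet> ?e"
    using e u v ue ve by (simp add: add_scalar_prod_distrib[of _ n] minus_scalar_prod_distrib[of _ n])
  also have "(?e + (?u - ?v)) \<bullet> (?u - ?v) = ?u \<bullet> ?u - 2 * (?u \<bullet> ?v) + ?v \<bullet> ?v"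
    using e u v eu ev vu
    by (simp add: add_scalar_prod_distrib[of _ n] minus_scalar_prod_distrib[of _ n] scalar_prod_minus_distrib[of _ n])
  finally have 1: "(y - ?v) \<bullet> (y - ?v) = rss y + (?u \<bullet> ?u - 2 * (?u \<bullet> ?v) + ?v \<bullet> ?v)"
    unfolding rss_def .
  have 2: "w \<bullet> w = ?v \<bullet> ?v - 2 * ?t * (?u \<bullet> ?v) + ?t\<^sup>2 * (?u \<bullet> ?u)"
    unfolding w using u v vu
    by (simp add: minus_scalar_prod_distrib[of _ n] scalar_prod_minus_distrib[of _ n] power2_eq_square algebra_simps)
  have 3: "ess y = ?u \<bullet> ?u" unfolding ess_def Pu ..
  define a b d where "a = ?u \<bullet> ?u" and "b = ?u \<bullet> ?v" and "d = ?v \<bullet> ?v"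
  have g1: "1 + g \<noteq> 0" using g by linarith
  have "a - 2 * b + d + d / g = a / (1 + g) + (1 + 1 / g) * (d - 2 * ?t * b + ?t\<^sup>2 * a)"
    using g g1 by (simp add: divide_simps power2_eq_square) (simp add: algebra_simps)
  then show ?thesis unfolding 1 2 3 a_def b_def d_def by simp
qed

text \<open>The vector \<open>d\<close> is orthogonal to the column space, so in the cross term the
  residual of \<open>e\<close> can be replaced by \<open>e\<close> itself.\<close>

lemma rss_add:
  assumes m: "m \<in> carrier_vec n" and e: "e \<in> carrier_vec n"
  defines "d \<equiv> m - col_proj M *\<^sub>v m"
  shows "rss (m + e) = d \<bullet> d + 2 * (d \<bullet> e) + e \<bullet> e - ess e"
proof -
  let ?P = "\<lambda>v. col_proj M *\<^sub>v v"
  have P: "?P m \<in> carrier_vec n" "?P e \<in> carrier_vec n" using m e by auto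
  have d: "d \<in> carrier_vec n" unfolding d_def using m P by simp
  have s: "m + e - ?P (m + e) = d + (e - ?P e)"
    unfolding mult_add_distrib_mat_vec[OF col_proj_carrier m e] d_def
    using carrier_vecD[OF m] carrier_vecD[OF e] carrier_vecD[OF P(1)] carrier_vecD[OF P(2)]
    by (intro eq_vecI) auto
  have f: "e - ?P e \<in> carrier_vec n" using e P by simp
  have dP: "d \<bullet> ?P e = 0" using col_proj_residual_orth[OF m, of "lsq e"] e col_proj_vec by (simp add: d_def)
  have "rss (m + e) = d \<bullet> d + 2 * (d \<bullet> (e - ?P e)) + (e - ?P e) \<bullet> (e - ?P e)"
    unfolding rss_def s using d f comm_scalar_prod[OF d f]
    by (simp add: add_scalar_prod_distrib[of _ n] scalar_prod_add_distrib[of _ n])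
  also have "d \<bullet> (e - ?P e) = d \<bullet> e" using scalar_prod_minus_distrib[OF d e P(2)] dP by simp
  also have "(e - ?P e) \<bullet> (e - ?P e) = e \<bullet> e - ess e" using rss_eq[OF e] by (simp add: rss_def)
  finally show ?thesis by simp
qed

text \<open>A left inverse N recovers v from M v, and Cauchy-Schwarz in each row of N bounds |v|^2
  by the squared entries of N. This coercivity makes the Gaussian integral over the coefficients
  finite.\<close>

lemma norm_le_mult:
  obtains C where "C > 0" "\<And>v. v \<in> carrier_vec k \<Longrightarrow> v \<bullet> v \<le> C * ((M *\<^sub>v v) \<bullet> (M *\<^sub>v v))"
proof -
  let ?N = "Gi * transpose_mat M"
  have N: "?N \<in> carrier_mat k n" by (rule mult_carrier_mat[OF Gi(1) Mt])
  let ?C = "\<Sum>i<k. \<Sum>r<n. (?N $$ (i,r))\<^sup>2"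
  have "v \<bullet> v \<le> (1 + ?C) * ((M *\<^sub>v v) \<bullet> (M *\<^sub>v v))" if v: "v \<in> carrier_vec k" for v
  proof -
    let ?w = "M *\<^sub>v v"
    have w: "dim_vec ?w = n" by simp
    have "v \<bullet> v = (\<Sum>i<k. (v $ i)\<^sup>2)" using v by (simp add: scalar_prod_self_sum)
    also have "\<dots> = (\<Sum>i<k. (\<Sum>r<n. ?N $$ (i,r) * ?w $ r)\<^sup>2)"
    proof (rule sum.cong, simp)
      fix i assume "i \<in> {..<k}"
      then have i: "i < k" by simp
      have "v $ i = (?N *\<^sub>v ?w) $ i" using lsq_mult[OF v] unfolding lsq_def by simp
      also have "\<dots> = (\<Sum>r<n. ?N $$ (i,r) * ?w $ r)"
        using i N w by (simp add: mult_mat_vec_def scalar_prod_def[of "row ?N i"] atLeast0LessThan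
            del: index_mult_mat dim_mult_mat_vec index_mult_mat_vec assoc_mult_mat_vec)
      finally show "(v $ i)\<^sup>2 = (\<Sum>r<n. ?N $$ (i,r) * ?w $ r)\<^sup>2" by simp
    qed
    also have "\<dots> \<le> (\<Sum>i<k. (\<Sum>r<n. (?N $$ (i,r))\<^sup>2) * (\<Sum>r<n. (?w $ r)\<^sup>2))"
      by (intro sum_mono Cauchy_Schwarz_ineq_sum)
    also have "\<dots> = ?C * (?w \<bullet> ?w)" by (simp add: sum_distrib_right scalar_prod_self_sum)
    \<comment> \<open>The added 1 keeps the constant positive where \<open>?C\<close> is 0, as for k
      = 0.\<close>
    also have "\<dots> \<le> (1 + ?C) * (?w \<bullet> ?w)" using scalar_prod_self_nonneg[of ?w] by (simp add: algebra_simps)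
    finally show ?thesis .
  qed
  moreover have "0 < 1 + ?C" by (simp add: add_pos_nonneg sum_nonneg)
  ultimately show ?thesis using that by blast
qed

end

section \<open>Column selections of the design matrix\<close>

lemma design_cols_carrier:
  assumes "X \<in> carrier_mat n p" "A \<subseteq> {..<p}"
  shows "design_cols X A \<in> carrier_mat n (card A)"
proof -
  have "{j. j < p \<and> j \<in> A} = A" using assms(2) by auto
  then show ?thesis using assms(1)
    unfolding design_cols_def by (intro carrier_matI) (auto simp: dim_submatrix)
qed

lemma design_cols_index:
  assumes "X \<in> carrier_mat n p" "A \<subseteq> {..<p}" "r < n" "i < card A"
  shows "design_cols X A $$ (r, i) = X $$ (r, pick A i)"
proof -
  have "{j. j < p \<and> j \<in> A} = A" using assms(2) by auto
  then show ?thesis using assms unfolding design_cols_def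
    by (subst submatrix_index) (auto simp: pick_UNIV)
qed

lemma bij_betw_pick:
  assumes "finite A"
  shows "bij_betw (pick A) {..<card A} A"
proof -
  have "inj_on (pick A) {..<card A}"
  proof (rule linorder_inj_onI)
    fix x y assume "x < y" "x \<in> {..<card A}" "y \<in> {..<card A}"
    then show "pick A x \<noteq> pick A y" using pick_mono[of y A x] by simp
  qed auto
  moreover have "pick A ` {..<card A} \<subseteq> A" by (auto intro: pick_in_set)
  ultimately show ?thesis
    by (metis assms bij_betw_def card_image card_lessThan card_subset_eq)
qed

text \<open>Coefficients are written as a function \<open>f\<close> of the predictor instead of the
  position in the submatrix. Models with different sets can then be compared by sums over
  predictors; \<open>vec_as_pick\<close> shows that every coefficient vector has this form.\<close>

lemma design_cols_mult_vec:
  assumes X: "X \<in> carrier_mat n p" and A: "A \<subseteq> {..<p}" and r: "r < n"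
  shows "(design_cols X A *\<^sub>v vec (card A) (\<lambda>i. f (pick A i))) $ r = (\<Sum>j\<in>A. X $$ (r, j) * f j)"
proof -
  have fin: "finite A" using A finite_subset by auto
  note D = design_cols_carrier[OF X A]
  have "(design_cols X A *\<^sub>v vec (card A) (\<lambda>i. f (pick A i))) $ r
    = (\<Sum>i<card A. X $$ (r, pick A i) * f (pick A i))"
    using r carrier_matD[OF D] design_cols_index[OF X A r]
    by (auto simp: scalar_prod_def atLeast0LessThan intro!: sum.cong)
  also have "\<dots> = (\<Sum>j\<in>A. X $$ (r, j) * f j)"
    by (rule sum.reindex_bij_betw[OF bij_betw_pick[OF fin]])
  finally show ?thesis .
qed

lemma vec_as_pick:
  assumes "finite A" "v \<in> carrier_vec (card A)"
  obtains f where "v = vec (card A) (\<lambda>i. f (pick A i))"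
proof
  let ?f = "\<lambda>j. v $ (inv_into {..<card A} (pick A) j)"
  show "v = vec (card A) (\<lambda>i. ?f (pick A i))"
    using assms bij_betw_pick[OF assms(1)]
    by (intro eq_vecI) (auto simp: bij_betw_def inv_into_f_f)
qed

text \<open>Coefficients of the smaller model are padded with zeros. In the overfitted case this
  puts the true mean into the column space of the larger model.\<close>

lemma design_cols_range_mono:
  assumes X: "X \<in> carrier_mat n p" and A: "A \<subseteq> A'" "A' \<subseteq> {..<p}" and v: "v \<in> carrier_vec (card A)"
  obtains w where "w \<in> carrier_vec (card A')" "design_cols X A *\<^sub>v v = design_cols X A' *\<^sub>v w"
proof -
  have fin: "finite A'" and Ap: "A \<subseteq> {..<p}" using A finite_subset by auto
  obtain f where f: "v = vec (card A) (\<lambda>i. f (pick A i))"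
    using vec_as_pick[OF _ v] fin A finite_subset by metis
  define f' where "f' j = (if j \<in> A then f j else 0)" for j
  let ?w = "vec (card A') (\<lambda>i. f' (pick A' i))"
  have "design_cols X A *\<^sub>v v = design_cols X A' *\<^sub>v ?w"
  proof (rule eq_vecI)
    fix r assume "r < dim_vec (design_cols X A' *\<^sub>v ?w)"
    then have r: "r < n" using carrier_matD[OF design_cols_carrier[OF X A(2)]] by simp
    have "(\<Sum>j\<in>A. X $$ (r, j) * f j) = (\<Sum>j\<in>A'. X $$ (r, j) * f' j)"
      using fin A(1) by (intro sum.mono_neutral_cong_left) (auto simp: f'_def)
    then show "(design_cols X A *\<^sub>v v) $ r = (design_cols X A' *\<^sub>v ?w) $ r"
      unfolding f design_cols_mult_vec[OF X Ap r] design_cols_mult_vec[OF X A(2) r] .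
  qed (use carrier_matD[OF design_cols_carrier[OF X A(2)]] carrier_matD[OF design_cols_carrier[OF X Ap]] in simp)
  then show ?thesis using that[of ?w] by simp
qed

text \<open>A kernel vector with a nonzero coefficient at predictor \<open>j\<close> can be solved
  for column \<open>j\<close>, which would express it by the other predictors.\<close>

lemma valid_design_full_rank:
  assumes vd: "valid_design n p X" and A: "A \<subseteq> {..<p}"
  shows "full_rank_mat (design_cols X A) n (card A)"
proof
  have X: "X \<in> carrier_mat n p" using vd unfolding valid_design_def by simp
  have fin: "finite A" using A finite_subset by auto
  show D: "design_cols X A \<in> carrier_mat n (card A)" by (rule design_cols_carrier[OF X A])
  show "full_col_rank (design_cols X A)" unfolding full_col_rank_def
  proof (intro ballI impI)
    fix v assume v': "v \<in> carrier_vec (dim_col (design_cols X A))"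
      and 0: "design_cols X A *\<^sub>v v = 0\<^sub>v (dim_row (design_cols X A))"
    have v: "v \<in> carrier_vec (card A)" using v' carrier_matD[OF D] by simp
    obtain f where f: "v = vec (card A) (\<lambda>i. f (pick A i))" using vec_as_pick[OF fin v] .
    have s0: "(\<Sum>j\<in>A. X $$ (r, j) * f j) = 0" if r: "r < n" for r
      using design_cols_mult_vec[OF X A r, of f] 0 r carrier_matD[OF D] unfolding f by simp
    have f0: "f j = 0" if j: "j \<in> A" for j
    proof (rule ccontr)
      assume nz: "f j \<noteq> 0"
      let ?c = "vec p (\<lambda>i. if i \<in> A - {j} then - f i / f j else 0)"
      have jp: "j < p" using j A by auto
      have "col X j = X *\<^sub>v ?c"
      proof (rule eq_vecI)
        fix r assume "r < dim_vec (X *\<^sub>v ?c)"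
        then have r: "r < n" using X by simp
        have "(X *\<^sub>v ?c) $ r = (\<Sum>i<p. X $$ (r,i) * (if i \<in> A - {j} then - f i / f j else 0))"
          using r X by (auto simp: scalar_prod_def atLeast0LessThan intro!: sum.cong)
        also have "\<dots> = (\<Sum>i\<in>A - {j}. X $$ (r,i) * (- f i / f j))"
          using A by (intro sum.mono_neutral_cong_right) auto
        also have "\<dots> = - (\<Sum>i\<in>A - {j}. X $$ (r,i) * f i) / f j"
          by (simp add: sum_divide_distrib sum_negf)
        also have "(\<Sum>i\<in>A - {j}. X $$ (r,i) * f i) = - (X $$ (r,j) * f j)"
          using s0[OF r] sum.remove[OF fin j, of "\<lambda>i. X $$ (r,i) * f i"] by linarith
        finally show "col X j $ r = (X *\<^sub>v ?c) $ r" using nz r jp X by simp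
      qed (use X in simp)
      moreover have "?c \<in> carrier_vec p \<and> ?c $ j = 0" using jp by simp
      ultimately show False using vd jp unfolding valid_design_def by blast
    qed
    show "v = 0\<^sub>v (dim_col (design_cols X A))"
      using carrier_matD[OF D] f0 bij_betw_pick[OF fin] unfolding f
      by (intro eq_vecI) (auto simp: bij_betw_def)
  qed
qed

text \<open>Cauchy-Schwarz in each row, followed by the squared column norm n - 1. The linear growth
  in n is what makes the explained sum of squares, divided by 1 + n, bounded.\<close>

lemma valid_design_mean_bound:
  assumes vd: "valid_design n p X" and A: "A \<subseteq> {..<p}" and v: "v \<in> carrier_vec (card A)"
  shows "(design_cols X A *\<^sub>v v) \<bullet> (design_cols X A *\<^sub>v v) \<le> real (card A) * (v \<bullet> v) * real n"
proof -
  have X: "X \<in> carrier_mat n p" using vd unfolding valid_design_def by simp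
  have fin: "finite A" using A finite_subset by auto
  note D = design_cols_carrier[OF X A]
  obtain f where f: "v = vec (card A) (\<lambda>i. f (pick A i))" using vec_as_pick[OF fin v] .
  have vv: "v \<bullet> v = (\<Sum>j\<in>A. (f j)\<^sup>2)"
    using sum.reindex_bij_betw[OF bij_betw_pick[OF fin], of "\<lambda>j. (f j)\<^sup>2"]
    unfolding f by (simp add: scalar_prod_self_sum)
  have cols: "(\<Sum>r<n. (X $$ (r,j))\<^sup>2) \<le> real n" if "j \<in> A" for j
  proof -
    have j: "j < p" using that A by auto
    have "(\<Sum>r<n. (X $$ (r,j))\<^sup>2) = col X j \<bullet> col X j"
      using X j by (simp add: scalar_prod_self_sum)
    then show ?thesis using vd j unfolding valid_design_def by simp
  qed
  have "(design_cols X A *\<^sub>v v) \<bullet> (design_cols X A *\<^sub>v v) = (\<Sum>r<n. (\<Sum>j\<in>A. X $$ (r, j) * f j)\<^sup>2)"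
    using carrier_matD[OF D] design_cols_mult_vec[OF X A, of _ f, folded f] by (simp add: scalar_prod_self_sum del: index_mult_mat_vec)
  also have "\<dots> \<le> (\<Sum>r<n. (\<Sum>j\<in>A. (X $$ (r, j))\<^sup>2) * (\<Sum>j\<in>A. (f j)\<^sup>2))"
    by (intro sum_mono Cauchy_Schwarz_ineq_sum)
  also have "\<dots> = (\<Sum>j\<in>A. \<Sum>r<n. (X $$ (r, j))\<^sup>2) * (v \<bullet> v)"
    unfolding vv sum_distrib_right[symmetric] by (subst sum.swap) simp
  also have "\<dots> \<le> (\<Sum>j\<in>A. real n) * (v \<bullet> v)"
    by (intro mult_right_mono sum_mono cols scalar_prod_self_nonneg)
  finally show ?thesis by (simp add: mult_ac)
qed

section \<open>Gaussian and inverse gamma integrals\<close>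

text \<open>Induction on the index set: the one-dimensional substitution is applied to the new
  coordinate under the integral over the others, and each coordinate contributes one factor
  \<open>t\<close>.\<close>

lemma nn_integral_PiM_lborel_affine:
  fixes d :: "'i \<Rightarrow> real" and t :: real
  assumes "finite I" "t > 0" "f \<in> borel_measurable (Pi\<^sub>M I (\<lambda>_. lborel))"
  shows "(\<integral>\<^sup>+x. f x \<partial>Pi\<^sub>M I (\<lambda>_. lborel))
    = ennreal (t ^ card I) * (\<integral>\<^sup>+x. f (\<lambda>i\<in>I. d i + t * x i) \<partial>Pi\<^sub>M I (\<lambda>_. lborel))"
  using assms(1,3)
proof (induction I arbitrary: f rule: finite_induct)
  interpret product_sigma_finite "\<lambda>_::'i. lborel :: real measure" ..
  case empty
  show ?case by (simp add: PiM_empty nn_integral_count_space_finite)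
next
  interpret product_sigma_finite "\<lambda>_::'i. lborel :: real measure" ..
  case (insert i I)
  let ?L = "\<lambda>_::'i. lborel :: real measure"
  note f[measurable] = insert.prems
  have f'[measurable]: "(\<lambda>(x, y). f (x(i := y))) \<in> borel_measurable (Pi\<^sub>M I ?L \<Otimes>\<^sub>M lborel)"
    using measurable_compose[OF measurable_add_dim f] by (simp add: case_prod_beta')
  define h where "h x = (\<integral>\<^sup>+y. f (x(i := d i + t * y)) \<partial>lborel)" for x
  have h[measurable]: "h \<in> borel_measurable (Pi\<^sub>M I ?L)"
  proof -
    have "(\<lambda>(x, y). f (x(i := d i + t * y))) \<in> borel_measurable (Pi\<^sub>M I ?L \<Otimes>\<^sub>M lborel)"
      using measurable_compose[of "\<lambda>(x, y). (x, d i + t * y)" "Pi\<^sub>M I ?L \<Otimes>\<^sub>M lborel", OF _ f']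
      by (simp add: case_prod_beta')
    then show ?thesis unfolding h_def by measurable
  qed
  have F: "(\<lambda>x. f (\<lambda>j\<in>insert i I. d j + t * x j)) \<in> borel_measurable (Pi\<^sub>M (insert i I) ?L)"
  proof (rule measurable_compose[OF _ f])
    show "(\<lambda>x. \<lambda>j\<in>insert i I. d j + t * x j) \<in> Pi\<^sub>M (insert i I) ?L \<rightarrow>\<^sub>M Pi\<^sub>M (insert i I) ?L"
      by (rule measurable_restrict) simp
  qed
  have upd: "(\<lambda>j\<in>I. d j + t * x j)(i := d i + t * y) = (\<lambda>j\<in>insert i I. d j + t * (x(i := y)) j)" for x y
    using insert.hyps by (auto simp: fun_eq_iff)
  have "(\<integral>\<^sup>+x. f x \<partial>Pi\<^sub>M (insert i I) ?L) = (\<integral>\<^sup>+x. (\<integral>\<^sup>+y. f (x(i := y)) \<partial>lborel) \<partial>Pi\<^sub>M I ?L)"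
    using insert.hyps by (intro product_nn_integral_insert f) auto
  also have "\<dots> = (\<integral>\<^sup>+x. ennreal t * h x \<partial>Pi\<^sub>M I ?L)"
  proof (rule nn_integral_cong)
    fix x assume x: "x \<in> space (Pi\<^sub>M I ?L)"
    have "(\<lambda>y. f (x(i := y))) \<in> borel_measurable lborel"
      using measurable_Pair2[OF f' x] by simp
    then show "(\<integral>\<^sup>+y. f (x(i := y)) \<partial>lborel) = ennreal t * h x"
      unfolding h_def using \<open>t > 0\<close> by (subst nn_integral_real_affine[of _ t "d i"]) auto
  qed
  also have "\<dots> = ennreal t * (\<integral>\<^sup>+x. h x \<partial>Pi\<^sub>M I ?L)" by (rule nn_integral_cmult) simp
  also have "(\<integral>\<^sup>+x. h x \<partial>Pi\<^sub>M I ?L) = ennreal (t ^ card I) * (\<integral>\<^sup>+x. h (\<lambda>i\<in>I. d i + t * x i) \<partial>Pi\<^sub>M I ?L)"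
    by (rule insert.IH[OF h])
  also have "(\<integral>\<^sup>+x. h (\<lambda>i\<in>I. d i + t * x i) \<partial>Pi\<^sub>M I ?L)
    = (\<integral>\<^sup>+x. f (\<lambda>j\<in>insert i I. d j + t * x j) \<partial>Pi\<^sub>M (insert i I) ?L)"
    unfolding h_def upd using insert.hyps by (intro product_nn_integral_insert[symmetric] F) auto
  finally show ?case using insert.hyps \<open>t > 0\<close>
    by (simp add: mult.assoc[symmetric] ennreal_mult[symmetric] del: restrict_apply)
qed

section \<open>The inverse gamma integral\<close>

definition ig_integral :: "real \<Rightarrow> real \<Rightarrow> ennreal" where
  "ig_integral al be = (\<integral>\<^sup>+x. ennreal (if 0 < x then x powr (- al - 1) * exp (- be / x) else 0) \<partial>lborel)"

lemma ig_integral_scale: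
  assumes "be > 0"
  shows "ig_integral al be = ennreal (be powr (- al)) * ig_integral al 1"
proof -
  let ?f = "\<lambda>b x. if 0 < x then x powr (- al - 1) * exp (- b / x) else (0::real)"
  have e: "?f be (be * x) = be powr (- al - 1) * ?f 1 x" for x
    using assms by (auto simp: powr_mult zero_less_mult_iff)
  have "ig_integral al be = ennreal be * (\<integral>\<^sup>+x. ennreal (?f be (0 + be * x)) \<partial>lborel)"
    unfolding ig_integral_def using assms by (subst nn_integral_real_affine[of _ be 0]) auto
  also have "(\<integral>\<^sup>+x. ennreal (?f be (0 + be * x)) \<partial>lborel)
    = (\<integral>\<^sup>+x. ennreal (be powr (- al - 1)) * ennreal (?f 1 x) \<partial>lborel)"
    unfolding add_0 e by (intro nn_integral_cong) (simp add: ennreal_mult')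
  also have "\<dots> = ennreal (be powr (- al - 1)) * ig_integral al 1"
    unfolding ig_integral_def by (rule nn_integral_cmult) simp
  also have "ennreal be * (ennreal (be powr (- al - 1)) * ig_integral al 1)
    = ennreal (be * be powr (- al - 1)) * ig_integral al 1"
    using assms by (simp add: ennreal_mult mult.assoc)
  also have "be * be powr (- al - 1) = be powr (- al)"
    using assms powr_add[of be 1 "- al - 1"] by simp
  finally show ?thesis .
qed

text \<open>This is t <= exp t at t = u / s, raised to the power s.\<close>

lemma powr_mult_exp_minus_le:
  fixes s u :: real
  assumes "s > 0" "u > 0"
  shows "u powr s * exp (- u) \<le> s powr s"
proof -
  have "u / s \<le> exp (u / s)" using exp_ge_add_one_self[of "u / s"] by linarith
  then have "(u / s) powr s \<le> exp (u / s) powr s" using assms by (intro powr_mono2) auto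
  also have "\<dots> = exp u" using assms by (simp add: powr_def)
  finally show ?thesis using assms by (simp add: powr_divide exp_minus field_simps)
qed

text \<open>On (0, 1] the exponential beats the power, by the previous estimate at u = 1/x; on [1,
  \<infinity>) the exponential is at most 1 and the power is integrable because al > 0.\<close>

lemma ig_integral_finite:
  assumes "al > 0"
  shows "ig_integral al 1 < \<infinity>"
proof -
  let ?s = "al + 1"
  let ?C = "?s powr ?s"
  have b1: "x powr (- al - 1) * exp (- 1 / x) \<le> ?C" if "x > 0" for x
    using powr_mult_exp_minus_le[of ?s "1 / x"] assms that by (simp add: powr_divide powr_minus_divide powr_diff powr_add field_simps)
  have b2: "x powr (- al - 1) * exp (- 1 / x) \<le> x powr (- al - 1)" if "x > 0" for x
    using that by (simp add: mult_left_le)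
  have fin2: "(\<integral>\<^sup>+x. ennreal (x powr (- al - 1)) * indicator {1..} x \<partial>lborel) = ennreal (0 - (- (1 powr (- al)) / al))"
  proof (rule nn_integral_FTC_atLeast)
    fix x :: real assume "1 \<le> x"
    then show "DERIV (\<lambda>x. - (x powr (- al)) / al) x :> x powr (- al - 1)"
      using assms by (auto intro!: derivative_eq_intros)
  next
    show "((\<lambda>x. - (x powr (- al)) / al) \<longlongrightarrow> 0) at_top"
      using assms tendsto_divide[OF tendsto_minus[OF tendsto_neg_powr[of "- al" "\<lambda>x. x" at_top]] tendsto_const[of al]] filterlim_ident
      by auto
  qed auto
  have "ig_integral al 1 \<le> (\<integral>\<^sup>+x. ennreal ?C * indicator {0..1} x + ennreal (x powr (- al - 1)) * indicator {1..} x \<partial>(lborel::real measure))"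
    unfolding ig_integral_def
  proof (rule nn_integral_mono)
    fix x :: real
    show "ennreal (if 0 < x then x powr (- al - 1) * exp (- 1 / x) else 0)
      \<le> ennreal ?C * indicator {0..1} x + ennreal (x powr (- al - 1)) * indicator {1..} x"
    proof (cases "x > 0")
      case True
      show ?thesis
      proof (cases "x \<le> 1")
        case T: True
        then have "ennreal (x powr (- al - 1) * exp (- 1 / x)) \<le> ennreal ?C * indicator {0..1} x"
          using True b1[OF True] by (simp add: ennreal_leI del: ennreal_le_iff)
        then show ?thesis using True by (simp add: add_increasing2)
      next
        case False
        then show ?thesis using True b2[OF True] by (simp add: ennreal_leI)
      qed
    qed simp
  qed
  also have "\<dots> = (\<integral>\<^sup>+x. ennreal ?C * indicator {0..1} x \<partial>(lborel::real measure)) + (\<integral>\<^sup>+x. ennreal (x powr (- al - 1)) * indicator {1..} x \<partial>(lborel::real measure))"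
    by (rule nn_integral_add) auto
  also have "\<dots> < \<infinity>" unfolding fin2 by (simp add: nn_integral_cmult ennreal_mult_less_top)
  finally show ?thesis .
qed

lemma ig_integral_pos: "0 < ig_integral al 1"
proof -
  \<comment> \<open>The minimum over both endpoints of [1, 2] covers increasing and decreasing
    powers alike, since no sign of the exponent is assumed; exp (- 1) is the smallest value of the
    exponential there.\<close>
  let ?c = "min (1 powr (- al - 1)) (2 powr (- al - 1)) * exp (- 1) :: real"
  have "(\<integral>\<^sup>+x. ennreal ?c * indicator {1..2} x \<partial>(lborel::real measure)) \<le> ig_integral al 1"
    unfolding ig_integral_def
  proof (rule nn_integral_mono)
    fix x :: real
    show "ennreal ?c * indicator {1..2} x \<le> ennreal (if 0 < x then x powr (- al - 1) * exp (- 1 / x) else 0)"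
    proof (cases "x \<in> {1..2}")
      case True
      have "min (1 powr (- al - 1)) (2 powr (- al - 1)) \<le> x powr (- al - 1)"
      proof (cases "- al - 1 \<ge> 0")
        case T: True
        then have "1 powr (- al - 1) \<le> x powr (- al - 1)" using True by (intro powr_mono2) auto
        then show ?thesis by linarith
      next
        case False
        then have "2 powr (- al - 1) \<le> x powr (- al - 1)" using True by (intro powr_mono2') auto
        then show ?thesis by linarith
      qed
      moreover have "exp (- 1) \<le> exp (- 1 / x)" using True by (simp add: field_simps)
      ultimately have "?c \<le> x powr (- al - 1) * exp (- 1 / x)" by (intro mult_mono) auto
      then show ?thesis using True by (simp add: ennreal_leI)
    qed simp
  qed
  moreover have "(\<integral>\<^sup>+x. ennreal ?c * indicator {1..2} x \<partial>(lborel::real measure)) = ennreal ?c"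
    by (simp add: nn_integral_cmult)
  moreover have "0 < ?c" by simp
  ultimately show ?thesis by (metis ennreal_less_zero_iff less_le_trans)
qed

text \<open>Mathematically \<open>Gamma al\<close>. It enters as a positive finite constant
  only.\<close>

definition ig_const :: "real \<Rightarrow> real" where
  "ig_const al = enn2real (ig_integral al 1)"

lemma ig_const_pos: "al > 0 \<Longrightarrow> 0 < ig_const al"
  unfolding ig_const_def using ig_integral_pos ig_integral_finite by (simp add: enn2real_positive_iff)

lemma ig_integral_eq: "al > 0 \<Longrightarrow> be > 0 \<Longrightarrow> ig_integral al be = ennreal (be powr (- al) * ig_const al)"
  unfolding ig_const_def using ig_integral_scale[of be al] ig_integral_finite[of al]
  by (simp add: ennreal_mult'' ennreal_enn2real_if)

section \<open>The Gaussian integral over the coefficients\<close>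

context full_rank_mat
begin

definition gram_form :: "(nat \<Rightarrow> real) \<Rightarrow> real" where
  "gram_form c = (M *\<^sub>v vec k c) \<bullet> (M *\<^sub>v vec k c)"

lemma mult_vec_index: "r < n \<Longrightarrow> (M *\<^sub>v vec k c) $ r = (\<Sum>i<k. M $$ (r, i) * c i)"
  by (auto simp: scalar_prod_def atLeast0LessThan intro!: sum.cong)

lemma gram_form_sum: "gram_form c = (\<Sum>r<n. (\<Sum>i<k. M $$ (r, i) * c i)\<^sup>2)"
  unfolding gram_form_def by (simp add: scalar_prod_self_sum mult_vec_index del: index_mult_mat_vec)

lemma gram_form_scale: "gram_form (\<lambda>i. t * c i) = t\<^sup>2 * gram_form c"
proof -
  have "(\<Sum>i<k. M $$ (r, i) * (t * c i))\<^sup>2 = t\<^sup>2 * (\<Sum>i<k. M $$ (r, i) * c i)\<^sup>2" for r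
    by (simp add: sum_distrib_left power_mult_distrib[symmetric] mult_ac)
  then show ?thesis unfolding gram_form_sum by (simp add: sum_distrib_left)
qed

lemma gram_form_cong: "(\<And>i. i < k \<Longrightarrow> c i = c' i) \<Longrightarrow> gram_form c = gram_form c'"
  unfolding gram_form_sum by (auto intro!: sum.cong)

abbreviation "coefs \<equiv> Pi\<^sub>M {..<k} (\<lambda>_. lborel :: real measure)"

lemma gram_form_measurable[measurable]: "gram_form \<in> borel_measurable coefs"
proof -
  have "(\<lambda>c. \<Sum>r<n. (\<Sum>i<k. M $$ (r, i) * c i)\<^sup>2) \<in> borel_measurable coefs" by measurable
  then show ?thesis unfolding gram_form_sum[abs_def] .
qed

lemma gram_form_shift_measurable[measurable]: "(\<lambda>c. gram_form (\<lambda>i. c i - d i)) \<in> borel_measurable coefs"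
proof -
  have "(\<lambda>c. \<Sum>r<n. (\<Sum>i<k. M $$ (r, i) * (c i - d i))\<^sup>2) \<in> borel_measurable coefs" by measurable
  then show ?thesis unfolding gram_form_sum[abs_def] .
qed

text \<open>Mathematically (2 pi)^(k/2) det(M^T M)^(-1/2). The same factor normalises the prior and
  comes out of the integral against the likelihood, so it cancels and no determinant has to be
  evaluated.\<close>

definition gauss_int :: ennreal where
  "gauss_int = (\<integral>\<^sup>+c. ennreal (exp (- gram_form c / 2)) \<partial>coefs)"

lemma nn_integral_exp_neg_sum_squares:
  assumes "C > 0"
  shows "0 < (\<integral>\<^sup>+c. ennreal (exp (- C * (\<Sum>i<k. (c i)\<^sup>2))) \<partial>coefs)"
    "(\<integral>\<^sup>+c. ennreal (exp (- C * (\<Sum>i<k. (c i)\<^sup>2))) \<partial>coefs) < \<infinity>"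
proof -
  interpret product_sigma_finite "\<lambda>_::nat. lborel :: real measure" ..
  \<comment> \<open>The standard deviation at which exp (- C x^2) is a multiple of the centred
    normal density.\<close>
  let ?s = "1 / sqrt (2 * C)"
  have "exp (- C * x\<^sup>2) = sqrt (2 * pi * ?s\<^sup>2) * normal_density 0 ?s x" for x
  proof -
    have "0 < sqrt (2 * pi * ?s\<^sup>2)" using assms by (simp add: real_sqrt_gt_0_iff)
    moreover have "- (x - 0)\<^sup>2 / (2 * ?s\<^sup>2) = - C * x\<^sup>2" using assms by (simp add: power_divide)
    ultimately show ?thesis using assms unfolding normal_density_def by simp
  qed
  then have "(\<integral>\<^sup>+x. ennreal (exp (- C * x\<^sup>2)) \<partial>lborel) = (\<integral>\<^sup>+x. ennreal (sqrt (2 * pi * ?s\<^sup>2)) * ennreal (normal_density 0 ?s x) \<partial>lborel)"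
    by (intro nn_integral_cong) (simp add: ennreal_mult' del: ennreal_mult)
  also have "\<dots> = ennreal (sqrt (2 * pi * ?s\<^sup>2)) * (\<integral>\<^sup>+x. ennreal (normal_density 0 ?s x) \<partial>lborel)"
    by (rule nn_integral_cmult) simp
  also have "(\<integral>\<^sup>+x. ennreal (normal_density 0 ?s x) \<partial>lborel) = 1"
    using assms by (subst nn_integral_eq_integral) auto
  finally have one: "(\<integral>\<^sup>+x. ennreal (exp (- C * x\<^sup>2)) \<partial>lborel) = ennreal (sqrt (2 * pi * ?s\<^sup>2))" by simp
  have "(\<integral>\<^sup>+c. ennreal (exp (- C * (\<Sum>i<k. (c i)\<^sup>2))) \<partial>coefs)
    = (\<integral>\<^sup>+c. (\<Prod>i\<in>{..<k}. ennreal (exp (- C * (c i)\<^sup>2))) \<partial>coefs)"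
    by (intro nn_integral_cong) (simp add: exp_sum[symmetric] sum_distrib_left prod_ennreal sum_negf)
  also have "\<dots> = (\<Prod>i\<in>{..<k}. \<integral>\<^sup>+x. ennreal (exp (- C * x\<^sup>2)) \<partial>lborel)"
    by (rule product_nn_integral_prod) auto
  also have "\<dots> = ennreal (sqrt (2 * pi * ?s\<^sup>2) ^ k)" unfolding one by (simp add: ennreal_power)
  finally have e: "(\<integral>\<^sup>+c. ennreal (exp (- C * (\<Sum>i<k. (c i)\<^sup>2))) \<partial>coefs) = ennreal (sqrt (2 * pi * ?s\<^sup>2) ^ k)" .
  have "0 < sqrt (2 * pi * ?s\<^sup>2)" using assms by (simp add: real_sqrt_gt_0_iff)
  then have "0 < sqrt (2 * pi * ?s\<^sup>2) ^ k" by (rule zero_less_power)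
  then show "0 < (\<integral>\<^sup>+c. ennreal (exp (- C * (\<Sum>i<k. (c i)\<^sup>2))) \<partial>coefs)"
    "(\<integral>\<^sup>+c. ennreal (exp (- C * (\<Sum>i<k. (c i)\<^sup>2))) \<partial>coefs) < \<infinity>"
    unfolding e by (simp_all only: ennreal_less_zero_iff) simp
qed

text \<open>\<open>gram_form\<close> dominates a positive multiple of the sum of squares, by
  \<open>norm_le_mult\<close>. The reverse comparison, by Cauchy-Schwarz, yields positivity in the
  next lemma.\<close>

lemma gauss_int_finite: "gauss_int < \<infinity>"
proof -
  obtain C where C: "C > 0" "\<And>v. v \<in> carrier_vec k \<Longrightarrow> v \<bullet> v \<le> C * ((M *\<^sub>v v) \<bullet> (M *\<^sub>v v))"
    using norm_le_mult by blast
  have "gauss_int \<le> (\<integral>\<^sup>+c. ennreal (exp (- (1 / (2 * C)) * (\<Sum>i<k. (c i)\<^sup>2))) \<partial>coefs)"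
    unfolding gauss_int_def
  proof (intro nn_integral_mono ennreal_leI)
    fix c :: "nat \<Rightarrow> real"
    have "(\<Sum>i<k. (c i)\<^sup>2) \<le> C * gram_form c"
      using C(2)[of "vec k c"] unfolding gram_form_def by (simp add: scalar_prod_self_sum[of "vec k c"])
    then show "exp (- gram_form c / 2) \<le> exp (- (1 / (2 * C)) * (\<Sum>i<k. (c i)\<^sup>2))"
      using C(1) by (simp add: field_simps)
  qed
  also have "\<dots> < \<infinity>" using nn_integral_exp_neg_sum_squares(2)[of "1 / (2 * C)"] C(1) by simp
  finally show ?thesis .
qed

lemma gauss_int_pos: "0 < gauss_int"
proof -
  let ?C = "1 + (\<Sum>r<n. \<Sum>i<k. (M $$ (r,i))\<^sup>2)"
  have C: "0 < ?C" by (simp add: add_pos_nonneg sum_nonneg)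
  have "0 < (\<integral>\<^sup>+c. ennreal (exp (- (?C / 2) * (\<Sum>i<k. (c i)\<^sup>2))) \<partial>coefs)"
    using nn_integral_exp_neg_sum_squares(1)[of "?C / 2"] C by simp
  also have "\<dots> \<le> gauss_int" unfolding gauss_int_def
  proof (intro nn_integral_mono ennreal_leI)
    fix c :: "nat \<Rightarrow> real"
    have "gram_form c \<le> (\<Sum>r<n. (\<Sum>i<k. (M $$ (r,i))\<^sup>2) * (\<Sum>i<k. (c i)\<^sup>2))"
      unfolding gram_form_sum by (intro sum_mono Cauchy_Schwarz_ineq_sum)
    also have "\<dots> \<le> ?C * (\<Sum>i<k. (c i)\<^sup>2)"
      unfolding sum_distrib_right[symmetric] by (intro mult_right_mono) (auto intro: sum_nonneg)
    finally show "exp (- (?C / 2) * (\<Sum>i<k. (c i)\<^sup>2)) \<le> exp (- gram_form c / 2)" by simp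
  qed
  finally show ?thesis .
qed

definition gauss_const :: real where "gauss_const = enn2real gauss_int"

lemma gauss_const_pos: "0 < gauss_const" and gauss_int_eq: "gauss_int = ennreal gauss_const"
  unfolding gauss_const_def using gauss_int_pos gauss_int_finite
  by (simp_all add: enn2real_positive_iff)

text \<open>Substitution of c = d + c' / sqrt \<tau>: the quadratic form absorbs \<tau>, and each of
  the k coordinates leaves a factor \<tau>^(-1/2).\<close>

lemma gauss_int_affine:
  assumes "\<tau> > 0"
  shows "(\<integral>\<^sup>+c. ennreal (exp (- (\<tau> / 2) * gram_form (\<lambda>i. c i - d i))) \<partial>coefs)
    = ennreal (\<tau> powr (- real k / 2) * gauss_const)"
proof -
  let ?t = "1 / sqrt \<tau>"
  have t: "?t > 0" using assms by simp
  have "(\<integral>\<^sup>+c. ennreal (exp (- (\<tau> / 2) * gram_form (\<lambda>i. c i - d i))) \<partial>coefs)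
    = ennreal (?t ^ card {..<k}) * (\<integral>\<^sup>+c. ennreal (exp (- (\<tau> / 2) * gram_form (\<lambda>i. (\<lambda>i\<in>{..<k}. d i + ?t * c i) i - d i))) \<partial>coefs)"
    by (rule nn_integral_PiM_lborel_affine[OF _ t]) simp_all
  also have "(\<integral>\<^sup>+c. ennreal (exp (- (\<tau> / 2) * gram_form (\<lambda>i. (\<lambda>i\<in>{..<k}. d i + ?t * c i) i - d i))) \<partial>coefs)
    = gauss_int" unfolding gauss_int_def
  proof (rule nn_integral_cong)
    fix c :: "nat \<Rightarrow> real"
    have "gram_form (\<lambda>i. (\<lambda>i\<in>{..<k}. d i + ?t * c i) i - d i) = gram_form (\<lambda>i. ?t * c i)"
      by (rule gram_form_cong) simp
    also have "\<dots> = gram_form c / \<tau>" unfolding gram_form_scale using assms by (simp add: power_divide)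
    finally show "ennreal (exp (- (\<tau> / 2) * gram_form (\<lambda>i. (\<lambda>i\<in>{..<k}. d i + ?t * c i) i - d i)))
      = ennreal (exp (- gram_form c / 2))" using assms by simp
  qed
  also have "?t ^ card {..<k} = \<tau> powr (- real k / 2)"
    using assms by (simp add: powr_realpow[symmetric] powr_half_sqrt[symmetric] powr_powr powr_minus_divide powr_divide)
  finally show ?thesis unfolding gauss_int_eq using gauss_const_pos by (simp add: ennreal_mult)
qed

end

section \<open>The marginal likelihood\<close>

lemma IG_density_nonneg: "al > 0 \<Longrightarrow> be \<ge> 0 \<Longrightarrow> 0 \<le> IG_density al be x"
  by (simp add: IG_density_def Gamma_real_pos)

lemma IG_density_measurable[measurable]: "IG_density al be \<in> borel_measurable borel"
  unfolding IG_density_def[abs_def] by measurable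

text \<open>All factors of the marginal likelihood that are common to the models; they cancel in
  every ratio.\<close>

definition marginal_const :: "real \<Rightarrow> real \<Rightarrow> nat \<Rightarrow> real" where
  "marginal_const a b n = (2 * pi) powr (- real n / 2) * (b powr a / Gamma a) * ig_const (a + real n / 2)"

lemma marginal_const_pos: "a > 0 \<Longrightarrow> b > 0 \<Longrightarrow> 0 < marginal_const a b n"
  unfolding marginal_const_def
  by (intro mult_pos_pos divide_pos_pos Gamma_real_pos ig_const_pos add_pos_nonneg) auto

text \<open>\<open>n_large\<close> is the range in which the ridge parameter is 0, so the prior is a
  pure g-prior.\<close>

locale regression_design =
  fixes X :: "real mat" and n p :: nat and A :: "nat set" and zeta :: real
  assumes valid: "valid_design n p X" and A_sub: "A \<subseteq> {..<p}" and n_large: "zeta < real n"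

sublocale regression_design \<subseteq> full_rank_mat "design_cols X A" n "card A"
  by (rule valid_design_full_rank[OF valid A_sub])

context regression_design
begin

lemma dim_row_X: "dim_row X = n"
  using valid unfolding valid_design_def by auto

lemma prior_kernel_eq:
  "prior_kernel zeta X A g s2 c = exp (- (1 / (g * s2) / 2) * gram_form c)"
proof -
  let ?M = "design_cols X A" and ?v = "vec (card A) c"
  have G: "transpose_mat ?M * ?M \<in> carrier_mat (card A) (card A)" by (rule mult_carrier_mat[OF Mt M])
  have v: "?v \<in> carrier_vec (card A)" by simp
  have lam: "ridge_lambda zeta (dim_row X) (card A) = 0"
    using n_large by (simp add: ridge_lambda_def dim_row_X)
  have "prior_precision zeta X A g s2 = (1 / (g * s2)) \<cdot>\<^sub>m (transpose_mat ?M * ?M)"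
    unfolding prior_precision_def Let_def lam using carrier_matD[OF G] by (intro eq_matI) auto
  then have "prior_precision zeta X A g s2 *\<^sub>v ?v = (1 / (g * s2)) \<cdot>\<^sub>v (transpose_mat ?M *\<^sub>v (?M *\<^sub>v ?v))"
    using carrier_matD[OF G] assoc_mult_mat_vec[OF Mt M v, symmetric]
    by (intro eq_vecI) (auto simp del: assoc_mult_mat_vec)
  moreover have "?v \<bullet> (transpose_mat ?M *\<^sub>v (?M *\<^sub>v ?v)) = gram_form c"
  proof -
    have Mv: "?M *\<^sub>v ?v \<in> carrier_vec n" by simp
    have tv: "transpose_mat ?M *\<^sub>v (?M *\<^sub>v ?v) \<in> carrier_vec (card A)" by (rule mult_mat_vec_carrier[OF Mt Mv])
    show ?thesis using transpose_vec_mult_scalar[OF M v Mv] comm_scalar_prod[OF v tv] by (simp add: gram_form_def)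
  qed
  ultimately show ?thesis unfolding prior_kernel_def Let_def by simp
qed

lemma prior_norm_eq:
  assumes "g > 0" "s2 > 0"
  shows "enn2real (\<integral>\<^sup>+c. ennreal (prior_kernel zeta X A g s2 c) \<partial>coef_space A)
    = (g * s2) powr (real (card A) / 2) * gauss_const"
proof -
  have "(1 / (g * s2)) powr (- real (card A) / 2) = (g * s2) powr (real (card A) / 2)"
    using assms by (simp add: powr_divide powr_minus_divide)
  then show ?thesis
    unfolding prior_kernel_eq coef_space_def
    using gauss_int_affine[of "1 / (g * s2)" "\<lambda>_. 0"] assms gauss_const_pos by simp
qed

text \<open>Prior and likelihood together have precision (1 + 1/g) / s2 times the Gram matrix, the
  prior alone 1 / (g s2) times it. The quotient of these factors is 1 + g, whence (1 + g)^(-k/2).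
  \<open>K\<close> carries the prior densities of g and s2 through the integral.\<close>

lemma likelihood_prior_integral:
  assumes g: "g > 0" and s2: "s2 > 0" and y: "y \<in> carrier_vec n" and K: "K \<ge> 0"
  shows "(\<integral>\<^sup>+c. ennreal (likelihood X A y s2 c * prior_density zeta X A g s2 c * K) \<partial>coef_space A)
    = ennreal ((2 * pi * s2) powr (- real n / 2) * exp (- (rss y + ess y / (1 + g)) / (2 * s2))
        * (1 + g) powr (- real (card A) / 2) * K)"
proof -
  let ?k = "real (card A)"
  let ?\<tau> = "(1 + 1 / g) / s2"
  let ?d = "\<lambda>i. (g / (1 + g)) * lsq y $ i"
  let ?E = "exp (- (rss y + ess y / (1 + g)) / (2 * s2))"
  let ?B = "(2 * pi * s2) powr (- real n / 2) * ?E * K / ((g * s2) powr (?k / 2) * gauss_const)"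
  have \<tau>: "?\<tau> > 0" using g s2 by (simp add: add_pos_pos)
  have B: "?B \<ge> 0" using K gauss_const_pos by simp
  have "likelihood X A y s2 c * prior_density zeta X A g s2 c * K
      = ?B * exp (- (?\<tau> / 2) * gram_form (\<lambda>i. c i - ?d i))" for c
  proof -
    let ?v = "vec (card A) c"
    let ?r = "y - design_cols X A *\<^sub>v ?v"
    have "vec (card A) (\<lambda>i. c i - ?d i) = ?v - (g / (1 + g)) \<cdot>\<^sub>v lsq y"
      using lsq_carrier[OF y] by (intro eq_vecI) auto
    then have sq: "?r \<bullet> ?r + gram_form c / g
      = rss y + ess y / (1 + g) + (1 + 1 / g) * gram_form (\<lambda>i. c i - ?d i)"
      using complete_square[OF y _ g, of ?v] by (simp add: gram_form_def)
    have "exp (- (?r \<bullet> ?r) / (2 * s2)) * exp (- (1 / (g * s2) / 2) * gram_form c)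
      = exp (- (?r \<bullet> ?r + gram_form c / g) / (2 * s2))"
      unfolding exp_add[symmetric] using g s2 by (simp add: field_simps)
    also have "\<dots> = ?E * exp (- (?\<tau> / 2) * gram_form (\<lambda>i. c i - ?d i))"
    proof -
      have "- (q + t * f) / (2 * s2) = - q / (2 * s2) + - (t / s2 / 2) * f" for q t f
        using s2 by (simp add: field_simps)
      from this[of "rss y + ess y / (1 + g)" "1 + 1 / g"] show ?thesis
        unfolding sq exp_add[symmetric] by (rule arg_cong)
    qed
    finally have e: "exp (- (?r \<bullet> ?r) / (2 * s2)) * exp (- (1 / (g * s2) / 2) * gram_form c)
      = ?E * exp (- (?\<tau> / 2) * gram_form (\<lambda>i. c i - ?d i))" .
    have "likelihood X A y s2 c * prior_density zeta X A g s2 c * K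
      = (2 * pi * s2) powr (- real n / 2)
        * (exp (- (?r \<bullet> ?r) / (2 * s2)) * exp (- (1 / (g * s2) / 2) * gram_form c))
        * K / ((g * s2) powr (?k / 2) * gauss_const)"
      unfolding likelihood_def prior_density_def Let_def prior_norm_eq[OF g s2]
      unfolding prior_kernel_eq dim_row_X by simp
    then show ?thesis unfolding e by (simp add: mult_ac)
  qed
  then have "(\<integral>\<^sup>+c. ennreal (likelihood X A y s2 c * prior_density zeta X A g s2 c * K) \<partial>coef_space A)
    = (\<integral>\<^sup>+c. ennreal ?B * ennreal (exp (- (?\<tau> / 2) * gram_form (\<lambda>i. c i - ?d i))) \<partial>coefs)"
    unfolding coef_space_def by (intro nn_integral_cong) (simp only: ennreal_mult[OF B exp_ge_zero])
  also have "\<dots> = ennreal ?B * (\<integral>\<^sup>+c. ennreal (exp (- (?\<tau> / 2) * gram_form (\<lambda>i. c i - ?d i))) \<partial>coefs)"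
    by (rule nn_integral_cmult) measurable
  also have "\<dots> = ennreal (?B * (?\<tau> powr (- ?k / 2) * gauss_const))"
    unfolding gauss_int_affine[OF \<tau>, of ?d] using B gauss_const_pos by (intro ennreal_mult[symmetric]) auto
  also have "?B * (?\<tau> powr (- ?k / 2) * gauss_const)
    = (2 * pi * s2) powr (- real n / 2) * ?E * (1 + g) powr (- ?k / 2) * K"
  proof -
    have "?\<tau> = (1 + g) / (g * s2)" using g s2 by (simp add: field_simps)
    then have "?\<tau> powr (- ?k / 2) = (1 + g) powr (- ?k / 2) * (g * s2) powr (?k / 2)"
      using g s2 by (simp add: powr_divide powr_minus_divide)
    moreover have "(g * s2) powr (?k / 2) > 0" using g s2 by simp
    ultimately show ?thesis using gauss_const_pos by (simp add: field_simps)
  qed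
  finally show ?thesis .
qed

text \<open>The factor s2^(-n/2) of the likelihood and the prior kernel combine to an inverse gamma
  kernel with shape a + n/2 and scale b + Q/2, where Q is the penalised sum of squares.\<close>

lemma sigma_integral:
  assumes ab: "a > 0" "b > 0" and y: "y \<in> carrier_vec n" and g: "g > 0" and K: "K \<ge> 0"
  shows "(\<integral>\<^sup>+s2. \<integral>\<^sup>+c. ennreal (likelihood X A y s2 c * prior_density zeta X A g s2 c * K * IG_density a b s2)
      \<partial>coef_space A \<partial>lborel)
    = ennreal (marginal_const a b n * (1 + g) powr (- real (card A) / 2)
        * (b + (rss y + ess y / (1 + g)) / 2) powr (- (a + real n / 2)) * K)"
proof -
  let ?Q = "rss y + ess y / (1 + g)"
  let ?al = "a + real n / 2"
  let ?C = "(2 * pi) powr (- real n / 2) * (b powr a / Gamma a) * (1 + g) powr (- real (card A) / 2) * K"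
  have Q: "?Q \<ge> 0" using rss_nonneg ess_nonneg g by simp
  have C: "?C \<ge> 0" using K Gamma_real_pos[OF ab(1)] by simp
  have al: "?al > 0" using ab by (simp add: add_pos_nonneg)
  have "(\<integral>\<^sup>+c. ennreal (likelihood X A y s2 c * prior_density zeta X A g s2 c * K * IG_density a b s2) \<partial>coef_space A)
    = ennreal ?C * ennreal (if 0 < s2 then s2 powr (- ?al - 1) * exp (- (b + ?Q / 2) / s2) else 0)" for s2
  proof (cases "s2 > 0")
    case True
    have KI: "0 \<le> K * IG_density a b s2" using K IG_density_nonneg[of a b s2] ab by simp
    have p1: "(2 * pi * s2) powr (- real n / 2) = (2 * pi) powr (- real n / 2) * s2 powr (- real n / 2)"
      by (rule powr_mult)
    have p2: "s2 powr (- real n / 2) * s2 powr (- a - 1) = s2 powr (- ?al - 1)"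
      unfolding powr_add[symmetric] by (simp add: algebra_simps)
    have e: "exp (- ?Q / (2 * s2)) * exp (- b / s2) = exp (- (b + ?Q / 2) / s2)"
      unfolding exp_add[symmetric] using True by (simp add: field_simps)
    have "(\<integral>\<^sup>+c. ennreal (likelihood X A y s2 c * prior_density zeta X A g s2 c * K * IG_density a b s2) \<partial>coef_space A)
      = ennreal ((2 * pi * s2) powr (- real n / 2) * exp (- ?Q / (2 * s2))
        * (1 + g) powr (- real (card A) / 2) * (K * IG_density a b s2))"
      using likelihood_prior_integral[OF g True y KI] by (simp add: mult.assoc)
    also have "(2 * pi * s2) powr (- real n / 2) * exp (- ?Q / (2 * s2))
        * (1 + g) powr (- real (card A) / 2) * (K * IG_density a b s2)
      = ?C * ((s2 powr (- real n / 2) * s2 powr (- a - 1)) * (exp (- ?Q / (2 * s2)) * exp (- b / s2)))"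
      unfolding p1 using True by (simp add: IG_density_def)
    also have "ennreal \<dots> = ennreal ?C * ennreal (s2 powr (- ?al - 1) * exp (- (b + ?Q / 2) / s2))"
      unfolding p2 e using C by (intro ennreal_mult) auto
    finally show ?thesis using True by simp
  qed (simp add: IG_density_def)
  then have "(\<integral>\<^sup>+s2. \<integral>\<^sup>+c. ennreal (likelihood X A y s2 c * prior_density zeta X A g s2 c * K * IG_density a b s2)
      \<partial>coef_space A \<partial>lborel) = ennreal ?C * ig_integral ?al (b + ?Q / 2)"
    unfolding ig_integral_def by (simp add: nn_integral_cmult)
  also have "\<dots> = ennreal (?C * ((b + ?Q / 2) powr (- ?al) * ig_const ?al))"
  proof -
    have "0 < b + ?Q / 2" using ab Q by (simp add: add_pos_nonneg)
    then have "ig_integral ?al (b + ?Q / 2) = ennreal ((b + ?Q / 2) powr (- ?al) * ig_const ?al)"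
      by (rule ig_integral_eq[OF al])
    then show ?thesis using ennreal_mult[OF C, of "(b + ?Q / 2) powr (- ?al) * ig_const ?al"] ig_const_pos[OF al]
      by simp
  qed
  finally show ?thesis unfolding marginal_const_def by (simp add: mult_ac)
qed

lemma marginal_lik_eq:
  assumes ab: "a > 0" "b > 0" and y: "y \<in> carrier_vec n"
  shows "marginal_lik a b zeta X A y = enn2real (\<integral>\<^sup>+g. ennreal (marginal_const a b n * (1 + g) powr (- real (card A) / 2)
        * (b + (rss y + ess y / (1 + g)) / 2) powr (- (a + real n / 2)) * IG_density (1/2) (real n / 2) g) \<partial>lborel)"
  unfolding marginal_lik_def
proof (intro arg_cong[of _ _ enn2real] nn_integral_cong)
  fix g :: real
  show "(\<integral>\<^sup>+ s2. \<integral>\<^sup>+ c. ennreal (likelihood X A y s2 c * prior_density zeta X A g s2 c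
                 * IG_density (1/2) (real (dim_row X) / 2) g * IG_density a b s2) \<partial>coef_space A \<partial>lborel)
    = ennreal (marginal_const a b n * (1 + g) powr (- real (card A) / 2)
        * (b + (rss y + ess y / (1 + g)) / 2) powr (- (a + real n / 2)) * IG_density (1/2) (real n / 2) g)"
  proof (cases "g > 0")
    case True
    show ?thesis unfolding dim_row_X
      by (rule sigma_integral[OF ab y True]) (simp add: IG_density_nonneg)
  next
    case False
    then show ?thesis by (simp add: IG_density_def)
  qed
qed

text \<open>Upper bound: dropping the explained part and replacing 1 + g by g leaves an inverse
  gamma kernel of shape (k + 1)/2 and scale n/2, whose integral together with the prior's
  (n/2)^(1/2) has order n^(-k/2). Lower bound: each factor is replaced by a lower bound valid on the
  whole of [n, 2n].\<close>

lemma marginal_lik_bounds: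
  assumes ab: "a > 0" "b > 0" and y: "y \<in> carrier_vec n" and n: "n > 0"
  shows "marginal_lik a b zeta X A y \<le> marginal_const a b n * (b + rss y / 2) powr (- (a + real n / 2))
      * (ig_const ((real (card A) + 1) / 2) / Gamma (1/2) * (real n / 2) powr (- real (card A) / 2))" (is ?upper)
    and "marginal_const a b n * (b + (rss y + ess y / (1 + real n)) / 2) powr (- (a + real n / 2))
      * (exp (- 1 / 2) / (4 * Gamma (1/2)) * (1 + 2 * real n) powr (- real (card A) / 2))
      \<le> marginal_lik a b zeta X A y" (is ?lower)
proof -
  let ?k = "real (card A)"
  let ?al = "a + real n / 2"
  let ?Q = "\<lambda>g. rss y + ess y / (1 + g)"
  let ?C = "marginal_const a b n"
  let ?f = "\<lambda>g. ?C * (1 + g) powr (- ?k / 2) * (b + ?Q g / 2) powr (- ?al) * IG_density (1/2) (real n / 2) g"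
  let ?D = "?C * (b + rss y / 2) powr (- ?al)"
  let ?I = "\<integral>\<^sup>+g. ennreal (?f g) \<partial>lborel"
  have C: "?C > 0" using marginal_const_pos[OF ab] .
  have al: "?al > 0" using ab by (simp add: add_pos_nonneg)
  have G: "Gamma (1/2 :: real) > 0" by (rule Gamma_real_pos) simp
  have rn: "real n > 0" using n by simp
  let ?U = "?D * ((real n / 2) powr (1/2) / Gamma (1/2))"
  have U: "?U \<ge> 0" using C G by simp
  have "?I \<le> (\<integral>\<^sup>+g. ennreal ?U * ennreal (if 0 < g then g powr (- ((?k + 1) / 2) - 1) * exp (- (real n / 2) / g) else 0) \<partial>lborel)"
  proof (rule nn_integral_mono)
    fix g :: real
    show "ennreal (?f g) \<le> ennreal ?U * ennreal (if 0 < g then g powr (- ((?k + 1) / 2) - 1) * exp (- (real n / 2) / g) else 0)"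
    proof (cases "g > 0")
      case True
      have "(1 + g) powr (- ?k / 2) \<le> g powr (- ?k / 2)" using True by (intro powr_mono2') auto
      moreover have "(b + ?Q g / 2) powr (- ?al) \<le> (b + rss y / 2) powr (- ?al)"
        using True ab al rss_nonneg[of y] ess_nonneg[of y] by (intro powr_mono2') (auto intro: add_pos_nonneg)
      ultimately have "?f g \<le> ?C * g powr (- ?k / 2) * (b + rss y / 2) powr (- ?al) * IG_density (1/2) (real n / 2) g"
        using C by (intro mult_right_mono mult_mono mult_left_mono) (auto simp: IG_density_nonneg)
      also have "\<dots> = ?U * ((g powr (- ?k / 2) * g powr (- (1/2) - 1)) * exp (- (real n / 2) / g))"
        using True by (simp add: IG_density_def mult_ac)
      also have "g powr (- ?k / 2) * g powr (- (1/2) - 1) = g powr (- ((?k + 1) / 2) - 1)"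
        unfolding powr_add[symmetric] by (simp add: field_simps)
      finally have "?f g \<le> ?U * (g powr (- ((?k + 1) / 2) - 1) * exp (- (real n / 2) / g))" .
      then show ?thesis using True U by (simp add: ennreal_mult[symmetric] ennreal_leI del: times_divide_eq_right)
    qed (simp add: IG_density_def)
  qed
  also have "\<dots> = ennreal ?U * ig_integral ((?k + 1) / 2) (real n / 2)"
    unfolding ig_integral_def by (rule nn_integral_cmult) measurable
  also have "\<dots> = ennreal (?U * ((real n / 2) powr (- ((?k + 1) / 2)) * ig_const ((?k + 1) / 2)))"
    using U rn ig_const_pos[of "(?k + 1) / 2"]
    by (subst ig_integral_eq) (auto intro!: ennreal_mult[symmetric] mult_nonneg_nonneg simp: less_imp_le simp del: times_divide_eq_right)
  also have "?U * ((real n / 2) powr (- ((?k + 1) / 2)) * ig_const ((?k + 1) / 2))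
    = ?D * (ig_const ((?k + 1) / 2) / Gamma (1/2) * ((real n / 2) powr (1/2) * (real n / 2) powr (- ((?k + 1) / 2))))"
    by simp
  also have "(real n / 2) powr (1/2) * (real n / 2) powr (- ((?k + 1) / 2)) = (real n / 2) powr (- ?k / 2)"
    unfolding powr_add[symmetric] by (simp add: field_simps)
  finally have ub: "?I \<le> ennreal (?D * (ig_const ((?k + 1) / 2) / Gamma (1/2) * (real n / 2) powr (- ?k / 2)))" .
  have nn: "0 \<le> ?D * (ig_const ((?k + 1) / 2) / Gamma (1/2) * (real n / 2) powr (- ?k / 2))"
    using C G ig_const_pos[of "(?k + 1) / 2"] by (auto intro!: mult_nonneg_nonneg divide_nonneg_nonneg simp: less_imp_le)
  show ?upper unfolding marginal_lik_eq[OF ab y] using enn2real_mono[OF ub] nn by simp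
  \<comment> \<open>\<open>enn2real\<close> sends infinity to 0, so a lower bound survives it only
    for a finite integral.\<close>
  have fin: "?I < \<infinity>" using ub by (rule le_less_trans) simp
  \<comment> \<open>The prior density on [n, 2n] is at least (n/2)^(1/2) (2n)^(-3/2) exp(-1/2) /
    Gamma(1/2), the power taken at g = 2n and the exponential at g = n; the two powers multiply to
    1/(4n). The length n of the interval later cancels this 1/n.\<close>
  let ?L = "?C * (b + ?Q (real n) / 2) powr (- ?al) * ((1 + 2 * real n) powr (- ?k / 2) * (exp (- 1 / 2) / (4 * Gamma (1/2) * real n)))"
  have "(\<integral>\<^sup>+g. ennreal ?L * indicator {real n..2 * real n} g \<partial>lborel) \<le> ?I"
  proof (rule nn_integral_mono)
    fix g :: real
    show "ennreal ?L * indicator {real n..2 * real n} g \<le> ennreal (?f g)"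
    proof (cases "g \<in> {real n..2 * real n}")
      case True
      have g: "g > 0" using True rn by auto
      have 1: "(1 + 2 * real n) powr (- ?k / 2) \<le> (1 + g) powr (- ?k / 2)"
        using True g by (intro powr_mono2') auto
      have "?Q g \<le> ?Q (real n)" using True rn ess_nonneg[of y] by (auto intro!: divide_left_mono)
      then have "b + ?Q g / 2 \<le> b + ?Q (real n) / 2" by (intro add_mono divide_right_mono) auto
      moreover have "0 < b + ?Q g / 2"
        using g ab rss_nonneg[of y] ess_nonneg[of y] by (auto intro: add_pos_nonneg)
      ultimately have 2: "(b + ?Q (real n) / 2) powr (- ?al) \<le> (b + ?Q g / 2) powr (- ?al)"
        using al by (intro powr_mono2') auto
      have 3: "exp (- 1 / 2) / (4 * Gamma (1/2) * real n) \<le> IG_density (1/2) (real n / 2) g"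
      proof -
        have "1 / (4 * real n) = (real n / 2) powr (1/2) * (2 * real n) powr (- (1/2) - 1)"
        proof -
          have "(real n / 2) powr (1/2) * (2 * real n) powr (1/2) = real n"
            using rn by (simp add: powr_half_sqrt real_sqrt_mult[symmetric] power2_eq_square[symmetric])
          then have "real n * (2 * real n) powr (- 2)
            = (real n / 2) powr (1/2) * ((2 * real n) powr (1/2) * (2 * real n) powr (- 2))"
            by (simp only: mult.assoc[symmetric])
          also have "(2 * real n) powr (1/2) * (2 * real n) powr (- 2) = (2 * real n) powr (- (1/2) - 1)"
            unfolding powr_add[symmetric] by simp
          finally have "(real n / 2) powr (1/2) * (2 * real n) powr (- (1/2) - 1) = real n * (1 / (4 * (real n)\<^sup>2))"
            using rn by (simp add: powr_minus_divide)
          then show ?thesis using rn by (simp add: power2_eq_square)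
        qed
        also have "\<dots> \<le> (real n / 2) powr (1/2) * g powr (- (1/2) - 1)"
          using True g by (intro mult_left_mono powr_mono2') auto
        finally have "1 / (4 * real n) \<le> (real n / 2) powr (1/2) * g powr (- (1/2) - 1)" .
        moreover have "exp (- 1 / 2) \<le> exp (- (real n / 2) / g)" using True g by (simp add: field_simps)
        ultimately have "1 / (4 * real n) * exp (- 1 / 2) \<le> (real n / 2) powr (1/2) * g powr (- (1/2) - 1) * exp (- (real n / 2) / g)"
          using rn by (intro mult_mono) auto
        then have "1 / (4 * real n) * exp (- 1 / 2) / Gamma (1/2) \<le> (real n / 2) powr (1/2) * g powr (- (1/2) - 1) * exp (- (real n / 2) / g) / Gamma (1/2)"
          using G by (intro divide_right_mono) auto
        then show ?thesis using g by (simp add: IG_density_def mult_ac)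
      qed
      have "?L \<le> ?C * (b + ?Q g / 2) powr (- ?al) * ((1 + g) powr (- ?k / 2) * IG_density (1/2) (real n / 2) g)"
        using 1 2 3 C G rn by (intro mult_mono mult_left_mono) (auto intro!: mult_nonneg_nonneg)
      then have "?L \<le> ?f g" by (simp only: mult_ac)
      then show ?thesis using True by (simp add: ennreal_leI)
    qed simp
  qed
  moreover have "(\<integral>\<^sup>+g. ennreal ?L * indicator {real n..2 * real n} g \<partial>lborel) = ennreal (?L * real n)"
  proof -
    have "(\<integral>\<^sup>+g. ennreal ?L * indicator {real n..2 * real n} g \<partial>lborel) = ennreal ?L * emeasure lborel {real n..2 * real n}"
      by (rule nn_integral_cmult_indicator) simp
    also have "emeasure lborel {real n..2 * real n} = ennreal (real n)" using rn by simp
    finally show ?thesis using ennreal_mult''[of "real n" ?L] by (simp only: of_nat_0_le_iff)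
  qed
  ultimately have "ennreal (?L * real n) \<le> ?I" by simp
  then have "enn2real (ennreal (?L * real n)) \<le> enn2real ?I" using fin by (intro enn2real_mono) auto
  moreover have "0 \<le> ?L * real n" using C G rn by auto
  moreover have "?L * real n = ?C * (b + ?Q (real n) / 2) powr (- ?al) * (exp (- 1 / 2) / (4 * Gamma (1/2)) * (1 + 2 * real n) powr (- ?k / 2))"
    using rn by simp
  ultimately show ?lower unfolding marginal_lik_eq[OF ab y] by simp
qed

end

section \<open>Convergence in probability and Gaussian noise\<close>

lemma conv_in_prob_zeroI:
  assumes good: "\<forall>\<^sub>F n in sequentially. B n \<in> sets (P n) \<and> (\<forall>y\<in>space (P n) - B n. \<bar>Z n y\<bar> \<le> r n)"
    and B: "(\<lambda>n. measure (P n) (B n)) \<longlonglongrightarrow> 0" and r: "r \<longlonglongrightarrow> 0"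
  shows "conv_in_prob P Z 0"
  unfolding conv_in_prob_def
proof (intro allI impI)
  fix e :: real assume "e > 0"
  then have re: "\<forall>\<^sub>F n in sequentially. r n < e" using r order_tendstoD(2) by blast
  let ?ok = "\<lambda>n. B n \<in> sets (P n) \<and> {y \<in> space (P n). e < \<bar>Z n y - 0\<bar>} \<subseteq> B n"
  have ok: "\<forall>\<^sub>F n in sequentially. ?ok n"
    using good re
  proof eventually_elim
    case (elim n)
    then have "y \<in> B n" if "y \<in> space (P n)" "e < \<bar>Z n y\<bar>" for y using that by force
    then show ?case using elim by auto
  qed
  \<comment> \<open>Covering sets are demanded for every n, while the hypothesis is eventual: at the
    remaining n the whole space is taken, which leaves the limit unchanged.\<close>
  let ?B = "\<lambda>n. if ?ok n then B n else space (P n)"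
  have "(\<lambda>n. measure (P n) (?B n)) \<longlonglongrightarrow> 0"
  proof (rule Lim_transform_eventually[OF B])
    show "\<forall>\<^sub>F n in sequentially. measure (P n) (B n) = measure (P n) (?B n)"
      using ok by eventually_elim simp
  qed
  moreover have "\<forall>n. ?B n \<in> sets (P n) \<and> {y \<in> space (P n). e < \<bar>Z n y - 0\<bar>} \<subseteq> ?B n" by auto
  ultimately show "\<exists>B. (\<forall>n. B n \<in> sets (P n) \<and> {y \<in> space (P n). e < \<bar>Z n y - 0\<bar>} \<subseteq> B n) \<and>
      (\<lambda>n. measure (P n) (B n)) \<longlonglongrightarrow> 0" by (intro exI[of _ ?B] conjI)
qed

lemma conv_in_probE:
  assumes "conv_in_prob P Z c" "e > 0"
  obtains B where "\<forall>n. B n \<in> sets (P n)" "\<forall>n. {y \<in> space (P n). e < \<bar>Z n y - c\<bar>} \<subseteq> B n"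
    "(\<lambda>n. measure (P n) (B n)) \<longlonglongrightarrow> 0"
proof -
  obtain B where B: "(\<forall>n. B n \<in> sets (P n) \<and> {y \<in> space (P n). e < \<bar>Z n y - c\<bar>} \<subseteq> B n)
       \<and> (\<lambda>n. measure (P n) (B n)) \<longlonglongrightarrow> 0"
    using assms unfolding conv_in_prob_def by (elim allE[of _ e] impE exE)
  show ?thesis by (rule that[of B]) (use B in auto)
qed

lemma conv_in_prob_dominated:
  assumes W: "conv_in_prob P W 0"
    and le: "\<forall>\<^sub>F n in sequentially. \<forall>y\<in>space (P n). \<bar>Z n y - c\<bar> \<le> \<bar>W n y\<bar>"
  shows "conv_in_prob P Z c"
  unfolding conv_in_prob_def
proof (intro allI impI)
  fix e :: real assume "e > 0"
  obtain B where B: "\<forall>n. B n \<in> sets (P n)" "\<forall>n. {y \<in> space (P n). e < \<bar>W n y - 0\<bar>} \<subseteq> B n"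
    "(\<lambda>n. measure (P n) (B n)) \<longlonglongrightarrow> 0"
    using conv_in_probE[OF W \<open>e > 0\<close>] .
  let ?ok = "\<lambda>n. {y \<in> space (P n). e < \<bar>Z n y - c\<bar>} \<subseteq> B n"
  let ?B = "\<lambda>n. if ?ok n then B n else space (P n)"
  have ok: "\<forall>\<^sub>F n in sequentially. ?ok n"
    using le
  proof eventually_elim
    case (elim n)
    then show ?case using B(2)[rule_format, of n] by force
  qed
  have "(\<lambda>n. measure (P n) (?B n)) \<longlonglongrightarrow> 0"
  proof (rule Lim_transform_eventually[OF B(3)])
    show "\<forall>\<^sub>F n in sequentially. measure (P n) (B n) = measure (P n) (?B n)"
      using ok by eventually_elim simp
  qed
  moreover have "\<forall>n. ?B n \<in> sets (P n) \<and> {y \<in> space (P n). e < \<bar>Z n y - c\<bar>} \<subseteq> ?B n" using B(1) by auto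
  ultimately show "\<exists>B. (\<forall>n. B n \<in> sets (P n) \<and> {y \<in> space (P n). e < \<bar>Z n y - c\<bar>} \<subseteq> B n) \<and>
      (\<lambda>n. measure (P n) (B n)) \<longlonglongrightarrow> 0" by (intro exI[of _ ?B] conjI)
qed

lemma conv_in_prob_add:
  assumes P: "\<And>n. prob_space (P n)" and Z: "conv_in_prob P Z 0" and W: "conv_in_prob P W 0"
  shows "conv_in_prob P (\<lambda>n y. Z n y + W n y) 0"
  unfolding conv_in_prob_def
proof (intro allI impI)
  fix e :: real assume "e > 0"
  then have e2: "e / 2 > 0" by simp
  obtain B where B: "\<forall>n. B n \<in> sets (P n)" "\<forall>n. {y \<in> space (P n). e / 2 < \<bar>Z n y - 0\<bar>} \<subseteq> B n"
    "(\<lambda>n. measure (P n) (B n)) \<longlonglongrightarrow> 0"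
    using conv_in_probE[OF Z e2] .
  obtain C where C: "\<forall>n. C n \<in> sets (P n)" "\<forall>n. {y \<in> space (P n). e / 2 < \<bar>W n y - 0\<bar>} \<subseteq> C n"
    "(\<lambda>n. measure (P n) (C n)) \<longlonglongrightarrow> 0"
    using conv_in_probE[OF W e2] .
  have "(\<lambda>n. measure (P n) (B n \<union> C n)) \<longlonglongrightarrow> 0"
  proof (rule tendsto_sandwich[OF _ _ tendsto_const])
    show "\<forall>\<^sub>F n in sequentially. measure (P n) (B n \<union> C n) \<le> measure (P n) (B n) + measure (P n) (C n)"
      using B(1) C(1) by (intro always_eventually allI measure_Un_le) auto
    show "(\<lambda>n. measure (P n) (B n) + measure (P n) (C n)) \<longlonglongrightarrow> 0"
      using tendsto_add[OF B(3) C(3)] by simp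
  qed simp
  moreover have "{y \<in> space (P n). e < \<bar>Z n y + W n y - 0\<bar>} \<subseteq> B n \<union> C n" for n
  proof
    fix y assume y: "y \<in> {y \<in> space (P n). e < \<bar>Z n y + W n y - 0\<bar>}"
    then have "e / 2 < \<bar>Z n y\<bar> \<or> e / 2 < \<bar>W n y\<bar>" by auto
    then show "y \<in> B n \<union> C n" using y B(2)[rule_format, of n] C(2)[rule_format, of n] by auto
  qed
  ultimately show "\<exists>B. (\<forall>n. B n \<in> sets (P n) \<and> {y \<in> space (P n). e < \<bar>Z n y + W n y - 0\<bar>} \<subseteq> B n) \<and>
      (\<lambda>n. measure (P n) (B n)) \<longlonglongrightarrow> 0" using B(1) C(1) by (intro exI[of _ "\<lambda>n. B n \<union> C n"]) auto
qed

lemma conv_in_prob_sum: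
  assumes P: "\<And>n. prob_space (P n)" and "finite I" "\<And>i. i \<in> I \<Longrightarrow> conv_in_prob P (Z i) 0"
  shows "conv_in_prob P (\<lambda>n y. \<Sum>i\<in>I. Z i n y) 0"
  using assms(2,3)
proof (induction I rule: finite_induct)
  case empty
  show ?case by (rule conv_in_prob_zeroI[where B="\<lambda>_. {}" and r="\<lambda>_. 0"]) auto
next
  case (insert i I)
  have "conv_in_prob P (\<lambda>n y. Z i n y + (\<Sum>i\<in>I. Z i n y)) 0"
    by (rule conv_in_prob_add[OF P]) (use insert in auto)
  then show ?case using insert.hyps by simp
qed

section \<open>Second moments under product and normal measures\<close>

lemma PiM_integral_component:
  fixes h :: "real \<Rightarrow> real"
  assumes N: "\<And>i. prob_space (N i)" and i: "i \<in> I" and h: "integrable (N i) h"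
  shows "integrable (Pi\<^sub>M I N) (\<lambda>y. h (y i))" "(\<integral>y. h (y i) \<partial>Pi\<^sub>M I N) = integral\<^sup>L (N i) h"
proof -
  have d: "distr (Pi\<^sub>M I N) (N i) (\<lambda>y. y i) = N i" by (rule distr_PiM_component[OF N i])
  have m: "(\<lambda>y. y i) \<in> Pi\<^sub>M I N \<rightarrow>\<^sub>M N i" using i by simp
  have hm: "h \<in> borel_measurable (N i)" using h by simp
  show "integrable (Pi\<^sub>M I N) (\<lambda>y. h (y i))" using h integrable_distr_eq[OF m hm] unfolding d by simp
  show "(\<integral>y. h (y i) \<partial>Pi\<^sub>M I N) = integral\<^sup>L (N i) h" using integral_distr[OF m hm] unfolding d by simp
qed

lemma PiM_integral_pair_centred:
  fixes f :: "'i \<Rightarrow> real \<Rightarrow> real"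
  assumes N: "\<And>i. prob_space (N i)" and I: "finite I" "i \<in> I" "j \<in> I" "i \<noteq> j"
    and f: "\<And>i. i \<in> I \<Longrightarrow> integrable (N i) (f i)" "\<And>i. i \<in> I \<Longrightarrow> integral\<^sup>L (N i) (f i) = 0"
  shows "integrable (Pi\<^sub>M I N) (\<lambda>y. f i (y i) * f j (y j))" "(\<integral>y. f i (y i) * f j (y j) \<partial>Pi\<^sub>M I N) = 0"
proof -
  interpret prob_space "N l" for l by (rule N)
  interpret product_sigma_finite N by standard
  \<comment> \<open>Putting the constant 1 at all other coordinates turns the pair into a full
    product over \<open>I\<close>, so that the integral factorises.\<close>
  let ?F = "\<lambda>l. if l = i \<or> l = j then f l else (\<lambda>_. 1)"
  have e: "(\<Prod>l\<in>I. ?F l (y l)) = f i (y i) * f j (y j)" for y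
  proof -
    have "(\<Prod>l\<in>I. ?F l (y l)) = (\<Prod>l\<in>{i,j}. ?F l (y l))"
      by (rule prod.mono_neutral_right) (use I in auto)
    then show ?thesis using I by simp
  qed
  have int: "integrable (N l) (?F l)" if "l \<in> I" for l using that f by auto
  show "integrable (Pi\<^sub>M I N) (\<lambda>y. f i (y i) * f j (y j))"
    using product_integrable_prod[of I ?F, OF I(1) int] unfolding e .
  have "(\<integral>y. f i (y i) * f j (y j) \<partial>Pi\<^sub>M I N) = (\<Prod>l\<in>I. integral\<^sup>L (N l) (?F l))"
    using product_integral_prod[of I ?F, OF I(1) int] unfolding e .
  also have "\<dots> = 0" using I f by (intro prod_zero) (auto intro!: bexI[of _ i])
  finally show "(\<integral>y. f i (y i) * f j (y j) \<partial>Pi\<^sub>M I N) = 0" .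
qed

text \<open>Distinct coordinates are orthogonal by independence and centring, so only the diagonal
  of the expanded square survives. It is used once with the noise itself and once with its centred
  squares.\<close>

lemma PiM_second_moment_sum:
  fixes f :: "'i \<Rightarrow> real \<Rightarrow> real" and c :: "'i \<Rightarrow> real"
  assumes N: "\<And>i. prob_space (N i)" and I: "finite I"
    and f: "\<And>i. i \<in> I \<Longrightarrow> integrable (N i) (f i)" "\<And>i. i \<in> I \<Longrightarrow> integral\<^sup>L (N i) (f i) = 0"
    and f2: "\<And>i. i \<in> I \<Longrightarrow> integrable (N i) (\<lambda>x. (f i x)\<^sup>2)" "\<And>i. i \<in> I \<Longrightarrow> (\<integral>x. (f i x)\<^sup>2 \<partial>N i) = v"
  shows "integrable (Pi\<^sub>M I N) (\<lambda>y. (\<Sum>i\<in>I. c i * f i (y i))\<^sup>2)"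
    "(\<integral>y. (\<Sum>i\<in>I. c i * f i (y i))\<^sup>2 \<partial>Pi\<^sub>M I N) = v * (\<Sum>i\<in>I. (c i)\<^sup>2)"
proof -
  let ?P = "Pi\<^sub>M I N"
  have sq: "(\<Sum>i\<in>I. c i * f i (y i))\<^sup>2 = (\<Sum>i\<in>I. \<Sum>j\<in>I. (c i * c j) * (f i (y i) * f j (y j)))" for y
    unfolding power2_eq_square sum_product by (simp add: mult_ac)
  have int: "integrable ?P (\<lambda>y. f i (y i) * f j (y j))
      \<and> (\<integral>y. f i (y i) * f j (y j) \<partial>?P) = (if i = j then v else 0)" if "i \<in> I" "j \<in> I" for i j
  proof (cases "i = j")
    case True
    then show ?thesis using PiM_integral_component[of N i I "\<lambda>x. (f i x)\<^sup>2", OF N that(1) f2(1)[OF that(1)]] f2(2)[OF that(1)]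
      by (simp add: power2_eq_square)
  next
    case False
    then show ?thesis using PiM_integral_pair_centred[of N I i j f, OF N I that False f] by simp
  qed
  show "integrable ?P (\<lambda>y. (\<Sum>i\<in>I. c i * f i (y i))\<^sup>2)"
    unfolding sq using int by (intro Bochner_Integration.integrable_sum integrable_mult_right) auto
  have "(\<integral>y. (\<Sum>i\<in>I. c i * f i (y i))\<^sup>2 \<partial>?P) = (\<Sum>i\<in>I. \<Sum>j\<in>I. (c i * c j) * (if i = j then v else 0))"
    unfolding sq using int
    by (simp add: Bochner_Integration.integral_sum Bochner_Integration.integrable_sum)
  also have "\<dots> = (\<Sum>i\<in>I. v * (c i)\<^sup>2)"
    using I by (intro sum.cong) (auto simp: if_distrib power2_eq_square mult_ac sum.delta cong: if_cong)
  finally show "(\<integral>y. (\<Sum>i\<in>I. c i * f i (y i))\<^sup>2 \<partial>?P) = v * (\<Sum>i\<in>I. (c i)\<^sup>2)"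
    by (simp add: sum_distrib_left)
qed

text \<open>The fourth central moment is 3 s^2, so the centred square has variance 3 s^2 - 2 s^2 +
  s^2 = 2 s^2.\<close>

lemma normal_central_moments:
  fixes m s :: real
  assumes s: "s > 0"
  defines "N \<equiv> density lborel (normal_density m (sqrt s))"
  shows "integrable N (\<lambda>x. x - m)" "(\<integral>x. (x - m) \<partial>N) = 0"
    "integrable N (\<lambda>x. (x - m)\<^sup>2)" "(\<integral>x. (x - m)\<^sup>2 \<partial>N) = s"
    "integrable N (\<lambda>x. (x - m)\<^sup>2 - s)" "(\<integral>x. ((x - m)\<^sup>2 - s) \<partial>N) = 0"
    "integrable N (\<lambda>x. ((x - m)\<^sup>2 - s)\<^sup>2)" "(\<integral>x. ((x - m)\<^sup>2 - s)\<^sup>2 \<partial>N) = 2 * s\<^sup>2"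
proof -
  have sp: "0 < sqrt s" using s by simp
  interpret prob_space N unfolding N_def by (rule prob_space_normal_density[OF sp])
  have i: "integrable N (\<lambda>x. (x - m) ^ j)" for j
    unfolding N_def using integrable_normal_moment[OF sp, of m j] by (subst integrable_density) auto
  have e: "(\<integral>x. (x - m) ^ j \<partial>N) = (\<integral>x. normal_density m (sqrt s) x * (x - m) ^ j \<partial>lborel)" for j
    unfolding N_def by (subst integral_density) auto
  show 1: "integrable N (\<lambda>x. x - m)" "(\<integral>x. (x - m) \<partial>N) = 0"
    using i[of 1] e[of 1] integral_normal_moment_odd[OF sp, of m 0] by simp_all
  show 2: "integrable N (\<lambda>x. (x - m)\<^sup>2)" by (rule i)
  show 3: "(\<integral>x. (x - m)\<^sup>2 \<partial>N) = s"
    using e[of 2] integral_normal_moment_even[OF sp, of m 1] s by (simp add: fact_numeral)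
  have 4: "(\<integral>x. (x - m)^4 \<partial>N) = 3 * s\<^sup>2"
    using e[of 4] integral_normal_moment_even[OF sp, of m 2] s by (simp add: fact_numeral power_divide)
  show "integrable N (\<lambda>x. (x - m)\<^sup>2 - s)" using 2 by simp
  show "(\<integral>x. ((x - m)\<^sup>2 - s) \<partial>N) = 0" using 2 3 by (simp add: prob_space)
  have x: "((x - m)\<^sup>2 - s)\<^sup>2 = (x - m)^4 - 2 * s * (x - m)\<^sup>2 + s\<^sup>2" for x
    by (simp add: power2_eq_square power4_eq_xxxx algebra_simps)
  show "integrable N (\<lambda>x. ((x - m)\<^sup>2 - s)\<^sup>2)" unfolding x using i[of 4] 2 by simp
  show "(\<integral>x. ((x - m)\<^sup>2 - s)\<^sup>2 \<partial>N) = 2 * s\<^sup>2" unfolding x using i[of 4] 2 3 4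
    by (simp add: prob_space power2_eq_square)
qed

locale gaussian_noise =
  fixes n :: nat and mu :: "nat \<Rightarrow> real" and s2 :: real
  assumes s2_pos: "s2 > 0"
begin

definition P :: "(nat \<Rightarrow> real) measure" where
  "P = Pi\<^sub>M {..<n} (\<lambda>r. density lborel (normal_density (mu r) (sqrt s2)))"

lemma prob_space_coord: "prob_space (density lborel (normal_density (mu r) (sqrt s2)))"
  by (rule prob_space_normal_density) (simp add: s2_pos)

lemma prob_space_P: "prob_space P"
  unfolding P_def by (rule prob_space_PiM[OF prob_space_coord])

lemma sets_P[measurable_cong]: "sets P = sets (Pi\<^sub>M {..<n} (\<lambda>_. borel))"
  unfolding P_def by (rule sets_PiM_cong) auto

lemma linear_noise_second_moment:
  "integrable P (\<lambda>y. (\<Sum>i<n. c i * (y i - mu i))\<^sup>2)"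
  "(\<integral>y. (\<Sum>i<n. c i * (y i - mu i))\<^sup>2 \<partial>P) = s2 * (\<Sum>i<n. (c i)\<^sup>2)"
  unfolding P_def
  by (rule PiM_second_moment_sum[where f="\<lambda>i x. x - mu i" and I="{..<n}" and v=s2 and c=c
      and N="\<lambda>r. density lborel (normal_density (mu r) (sqrt s2))",
      OF prob_space_coord finite_lessThan normal_central_moments(1-4)[OF s2_pos]])+

lemma square_noise_second_moment:
  "integrable P (\<lambda>y. (\<Sum>i<n. (y i - mu i)\<^sup>2 - s2)\<^sup>2)"
  "(\<integral>y. (\<Sum>i<n. (y i - mu i)\<^sup>2 - s2)\<^sup>2 \<partial>P) = 2 * s2\<^sup>2 * real n"
proof -
  note * = PiM_second_moment_sum[where f="\<lambda>i x. (x - mu i)\<^sup>2 - s2" and I="{..<n}" and v="2 * s2\<^sup>2" and c="\<lambda>_. 1"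
      and N="\<lambda>r. density lborel (normal_density (mu r) (sqrt s2))",
      OF prob_space_coord finite_lessThan normal_central_moments(5-8)[OF s2_pos]]
  show "integrable P (\<lambda>y. (\<Sum>i<n. (y i - mu i)\<^sup>2 - s2)\<^sup>2)"
    "(\<integral>y. (\<Sum>i<n. (y i - mu i)\<^sup>2 - s2)\<^sup>2 \<partial>P) = 2 * s2\<^sup>2 * real n"
    using * unfolding P_def by simp_all
qed

lemma chebyshev_linear:
  assumes "\<delta> > 0"
  shows "measure P {y\<in>space P. \<delta> \<le> \<bar>\<Sum>i<n. c i * (y i - mu i)\<bar>} \<le> s2 * (\<Sum>i<n. (c i)\<^sup>2) / \<delta>\<^sup>2"
proof -
  interpret prob_space P by (rule prob_space_P)
  have "(\<lambda>y. \<Sum>i<n. c i * (y i - mu i)) \<in> borel_measurable P" by measurable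
  from second_moment_method[OF this linear_noise_second_moment(1) assms]
  show ?thesis unfolding linear_noise_second_moment(2) .
qed

lemma chebyshev_square:
  assumes "\<delta> > 0" "n > 0"
  shows "measure P {y\<in>space P. \<delta> * real n \<le> \<bar>(\<Sum>i<n. (y i - mu i)\<^sup>2) - real n * s2\<bar>} \<le> 2 * s2\<^sup>2 / \<delta>\<^sup>2 / real n"
proof -
  interpret prob_space P by (rule prob_space_P)
  have "measure P {y\<in>space P. \<delta> * real n \<le> \<bar>\<Sum>i<n. (y i - mu i)\<^sup>2 - s2\<bar>} \<le> 2 * s2\<^sup>2 * real n / (\<delta> * real n)\<^sup>2"
  proof -
    have "(\<lambda>y. \<Sum>i<n. (y i - mu i)\<^sup>2 - s2) \<in> borel_measurable P" by measurable
    from second_moment_method[OF this square_noise_second_moment(1), of "\<delta> * real n"] assms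
    show ?thesis unfolding square_noise_second_moment(2) by simp
  qed
  also have "\<dots> = 2 * s2\<^sup>2 / \<delta>\<^sup>2 / real n" using assms by (simp add: power2_eq_square)
  finally show ?thesis by (simp add: sum_subtractf)
qed

text \<open>Meant for \<open>H\<close> a projector, where the double sum of squares is its rank and
  the bound does not grow with n.\<close>

lemma markov_projected:
  assumes "L > 0"
  shows "measure P {y\<in>space P. L \<le> (\<Sum>r<n. (\<Sum>i<n. H r i * (y i - mu i))\<^sup>2)}
    \<le> s2 * (\<Sum>r<n. \<Sum>i<n. (H r i)\<^sup>2) / L"
proof -
  interpret prob_space P by (rule prob_space_P)
  have "measure P {y\<in>space P. L \<le> (\<Sum>r<n. (\<Sum>i<n. H r i * (y i - mu i))\<^sup>2)}
    \<le> (\<integral>y. (\<Sum>r<n. (\<Sum>i<n. H r i * (y i - mu i))\<^sup>2) \<partial>P) / L"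
    using assms linear_noise_second_moment(1)
    by (intro integral_Markov_inequality_measure[of _ _ "{}"] AE_I2 sum_nonneg) auto
  also have "(\<integral>y. (\<Sum>r<n. (\<Sum>i<n. H r i * (y i - mu i))\<^sup>2) \<partial>P) = s2 * (\<Sum>r<n. \<Sum>i<n. (H r i)\<^sup>2)"
    using linear_noise_second_moment by (simp add: sum_distrib_left)
  finally show ?thesis .
qed

end

section \<open>Posterior consistency\<close>

lemma marginal_lik_pos:
  assumes "regression_design X n p A zeta" "a > 0" "b > 0" "y \<in> carrier_vec n" "n > 0"
  shows "0 < marginal_lik a b zeta X A y"
proof -
  interpret regression_design X n p A zeta by fact
  have "0 < b + (rss y + ess y / (1 + real n)) / 2"
    using assms(3) rss_nonneg[of y] ess_nonneg[of y] by (auto intro!: add_pos_nonneg)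
  moreover have "Gamma (1/2 :: real) > 0" by (rule Gamma_real_pos) simp
  ultimately have "0 < marginal_const a b n * (b + (rss y + ess y / (1 + real n)) / 2) powr (- (a + real n / 2))
      * (exp (- 1 / 2) / (4 * Gamma (1/2)) * (1 + 2 * real n) powr (- real (card A) / 2))"
    using marginal_const_pos[OF assms(2,3), of n] by (intro mult_pos_pos divide_pos_pos) auto
  then show ?thesis using marginal_lik_bounds(2)[OF assms(2-5)] by linarith
qed

text \<open>The constant of the upper bound on the marginal likelihood divided by exp(-1/2) / 4 from
  the lower bound; Gamma(1/2) cancels.\<close>

definition ratio_const :: "nat \<Rightarrow> real" where
  "ratio_const k = 4 * exp (1 / 2) * ig_const ((real k + 1) / 2)"

lemma ratio_const_pos: "0 < ratio_const k"
  unfolding ratio_const_def by (simp add: ig_const_pos)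

(* The upper bound uses all g, the lower bound only g in [n, 2n], where the prior IG(1/2, n/2) has mass bounded
   below; this loses only constants. *)
lemma marginal_lik_ratio_le:
  assumes A: "regression_design X n p A zeta" and A': "regression_design X n p A' zeta"
    and ab: "a > 0" "b > 0" and y: "y \<in> carrier_vec n" and n: "n > 0"
  defines "R \<equiv> full_rank_mat.rss (design_cols X A) y" and "S \<equiv> full_rank_mat.ess (design_cols X A) y"
    and "R' \<equiv> full_rank_mat.rss (design_cols X A') y"
  shows "marginal_lik a b zeta X A' y / marginal_lik a b zeta X A y
    \<le> ratio_const (card A') * (real n / 2) powr (- real (card A') / 2) * (1 + 2 * real n) powr (real (card A) / 2)
      * ((2 * b + R + S / (1 + real n)) / (2 * b + R')) powr (a + real n / 2)"
proof -
  interpret A: regression_design X n p A zeta by fact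
  interpret A': regression_design X n p A' zeta by fact
  let ?al = "a + real n / 2"
  let ?C = "marginal_const a b n" and ?G = "Gamma (1/2 :: real)"
  let ?k = "real (card A)" and ?k' = "real (card A')"
  let ?N = "(2 * b + R + S / (1 + real n)) / 2" and ?D = "(2 * b + R') / 2"
  let ?J = "ig_const ((?k' + 1) / 2)"
  have C: "?C > 0" using marginal_const_pos[OF ab] .
  have G: "?G > 0" by (rule Gamma_real_pos) simp
  have R: "R \<ge> 0" "S \<ge> 0" "R' \<ge> 0"
    unfolding R_def S_def R'_def by (rule A.rss_nonneg A.ess_nonneg A'.rss_nonneg)+
  have N: "?N > 0" and D: "?D > 0" using R ab by (auto intro!: add_pos_nonneg)
  have J: "?J > 0" by (rule ig_const_pos) simp
  have u: "marginal_lik a b zeta X A' y \<le> ?C * ?D powr (- ?al) * (?J / ?G * (real n / 2) powr (- ?k' / 2))"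
    using A'.marginal_lik_bounds(1)[OF ab y n] unfolding R'_def by (simp add: add_divide_distrib)
  have l: "?C * ?N powr (- ?al) * (exp (- 1 / 2) / (4 * ?G) * (1 + 2 * real n) powr (- ?k / 2)) \<le> marginal_lik a b zeta X A y"
    using A.marginal_lik_bounds(2)[OF ab y n] unfolding R_def S_def by (simp add: add_divide_distrib add.assoc)
  have lp: "0 < ?C * ?N powr (- ?al) * (exp (- 1 / 2) / (4 * ?G) * (1 + 2 * real n) powr (- ?k / 2))"
    using C G N by (intro mult_pos_pos divide_pos_pos) auto
  have "marginal_lik a b zeta X A' y / marginal_lik a b zeta X A y
    \<le> (?C * ?D powr (- ?al) * (?J / ?G * (real n / 2) powr (- ?k' / 2)))
      / (?C * ?N powr (- ?al) * (exp (- 1 / 2) / (4 * ?G) * (1 + 2 * real n) powr (- ?k / 2)))"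
    using u l lp C D G J by (intro frac_le) (auto intro!: mult_nonneg_nonneg divide_nonneg_nonneg simp: less_imp_le)
  also have "\<dots> = 4 * exp (1 / 2) * ?J * (real n / 2) powr (- ?k' / 2) * (1 + 2 * real n) powr (?k / 2) * (?N powr ?al / ?D powr ?al)"
  proof -
    have e: "exp (- 1 / 2) = 1 / exp (1 / 2 :: real)" by (simp add: exp_minus inverse_eq_divide)
    have z: "(1 + 2 * real n) powr (- ?k / 2) = 1 / (1 + 2 * real n) powr (?k / 2)"
      by (simp add: powr_minus_divide)
    \<comment> \<open>The powers and exponentials are abstracted to variables, so that the
      cancellation of \<open>?C\<close> and of Gamma(1/2) becomes plain field arithmetic.\<close>
    have *: "?C * (1 / d) * (J / G * m) / (?C * (1 / x) * (1 / e / (4 * G) * (1 / z))) = 4 * e * J * m * z * (x / d)"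
      if "d > 0" "x > 0" "G > 0" "e > 0" "z > 0" for d x G e z J m :: real
      using that C by (simp add: field_simps)
    show ?thesis unfolding powr_minus_divide[of _ ?al] e z
      by (rule *) (use N D G in \<open>auto simp del: Gamma_one_half_real\<close>)
  qed
  also have "?N powr ?al / ?D powr ?al = (?N / ?D) powr ?al" by (rule powr_divide[symmetric])
  also have "?N / ?D = (2 * b + R + S / (1 + real n)) / (2 * b + R')"
  proof -
    have "u / 2 / (v / 2) = u / v" for u v :: real by simp
    then show ?thesis .
  qed
  finally show ?thesis unfolding ratio_const_def .
qed

section \<open>Deterministic asymptotics of the two kinds of ratio\<close>

lemma powr_times_exp_neg_tendsto_0:
  fixes h c a :: real
  assumes "h > 0" "c > 0"
  shows "(\<lambda>n. (1 + 2 * real n) powr h * exp (- c * (a + real n / 2))) \<longlonglongrightarrow> 0"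
  using assms by real_asymp

text \<open>exp (c sqrt (ln n)) is n to the power c / sqrt (ln n), hence eventually below every
  fixed positive power of n.\<close>

lemma inv_sqrt_times_exp_sqrt_ln_tendsto_0:
  fixes c D :: real
  assumes "c > 0"
  shows "(\<lambda>n. (real n / 2) powr (- 1 / 2) * exp (c * (D + sqrt (ln (real n))))) \<longlonglongrightarrow> 0"
  using assms by real_asymp

lemma sqrt_ln_le_linear:
  fixes c :: real
  assumes "c > 0"
  shows "\<forall>\<^sub>F n in sequentially. sqrt (ln (real n)) \<le> c * real n"
  using assms by real_asymp

lemma inverse_sqrt_ln_tendsto_0: "(\<lambda>n. c / sqrt (ln (real n))) \<longlonglongrightarrow> 0"
  by real_asymp

text \<open>The quotient is at most a fixed \<rho> < 1, because \<beta> n outweighs all deviations.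
  Its power a + n/2 is exponentially small and absorbs the polynomial factor.\<close>

lemma misspecified_ratio_vanishes:
  fixes s2 \<beta> b D a h :: real and dd :: "nat \<Rightarrow> real"
  assumes s2: "s2 > 0" and \<beta>: "\<beta> > 0" and b: "b > 0" and h: "h > 0" and a: "a > 0" and D: "D \<ge> 0"
    and dd: "(\<lambda>n. dd n / real n) \<longlonglongrightarrow> \<beta>"
  obtains r where "r \<longlonglongrightarrow> 0"
    "\<forall>\<^sub>F n in sequentially. \<forall>E q x. 0 \<le> E \<longrightarrow> \<bar>E - real n * s2\<bar> \<le> \<beta> / 8 * real n \<longrightarrow> q \<le> sqrt (ln (real n)) \<longrightarrow> \<bar>x\<bar> \<le> \<beta> / 8 * real n \<longrightarrow>
      (1 + 2 * real n) powr h * ((2 * b + E + D) / (2 * b + (dd n + 2 * x + E - q))) powr (a + real n / 2) \<le> r n"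
proof -
  define \<rho> where "\<rho> = (s2 + \<beta> / 4) / (s2 + \<beta> / 2)"
  have \<rho>: "0 < \<rho>" "\<rho> < 1" unfolding \<rho>_def using s2 \<beta> by (auto simp: field_simps add_pos_pos)
  define c where "c = - ln \<rho>"
  have c: "c > 0" unfolding c_def using \<rho> by simp
  let ?r = "\<lambda>n. (1 + 2 * real n) powr h * exp (- c * (a + real n / 2))"
  \<comment> \<open>Budget in sixteenths of \<beta> n: the denominator gains 15 from
    \<open>dd n\<close> and loses 4 through \<open>2 * x\<close>, 2 through \<open>E\<close> and 1
    through \<open>q\<close>, which leaves 8, the \<beta>/2 in \<rho>. The numerator exceeds n s2 by
    2 through \<open>E\<close> and 2 through \<open>2 * b + D\<close>, the \<beta>/4 in
    \<rho>.\<close>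
  have "15 / 16 * \<beta> < \<beta>" using \<beta> by simp
  then have e1: "\<forall>\<^sub>F n in sequentially. 15 / 16 * \<beta> < dd n / real n" using dd order_tendstoD(1) by blast
  have e2: "\<forall>\<^sub>F n in sequentially. sqrt (ln (real n)) \<le> \<beta> / 16 * real n" using \<beta> by (intro sqrt_ln_le_linear) simp
  have e3: "\<forall>\<^sub>F n in sequentially. 2 * b + D \<le> \<beta> / 8 * real n" using \<beta> by real_asymp
  have "\<forall>\<^sub>F n in sequentially. \<forall>E q x. 0 \<le> E \<longrightarrow> \<bar>E - real n * s2\<bar> \<le> \<beta> / 8 * real n \<longrightarrow> q \<le> sqrt (ln (real n)) \<longrightarrow> \<bar>x\<bar> \<le> \<beta> / 8 * real n \<longrightarrow>
      (1 + 2 * real n) powr h * ((2 * b + E + D) / (2 * b + (dd n + 2 * x + E - q))) powr (a + real n / 2) \<le> ?r n"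
    using e1 e2 e3 eventually_gt_at_top[of 0]
  proof eventually_elim
    case (elim n)
    show ?case
    proof (intro allI impI)
      fix E q x :: real
      assume E0: "0 \<le> E" and E: "\<bar>E - real n * s2\<bar> \<le> \<beta> / 8 * real n" and q: "q \<le> sqrt (ln (real n))" and x: "\<bar>x\<bar> \<le> \<beta> / 8 * real n"
      have n: "real n > 0" using elim by simp
      have d: "15 / 16 * \<beta> * real n \<le> dd n" using elim(1) n by (simp add: field_simps)
      have "real n * s2 \<le> E + \<beta> / 8 * real n" "E \<le> real n * s2 + \<beta> / 8 * real n" "- x \<le> \<beta> / 8 * real n" using E x by linarith+
      then have den: "real n * s2 + \<beta> / 2 * real n \<le> 2 * b + (dd n + 2 * x + E - q)"
        using d q elim(2) b by (simp add: algebra_simps)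
      have num: "2 * b + E + D \<le> real n * s2 + \<beta> / 4 * real n"
        using \<open>E \<le> real n * s2 + \<beta> / 8 * real n\<close> elim(3) by (simp add: algebra_simps)
      have dp: "0 < real n * s2 + \<beta> / 2 * real n" using n s2 \<beta> by (simp add: add_pos_pos)
      have np: "0 \<le> real n * s2 + \<beta> / 4 * real n" using n s2 \<beta> by simp
      have "(2 * b + E + D) / (2 * b + (dd n + 2 * x + E - q)) \<le> (real n * s2 + \<beta> / 4 * real n) / (real n * s2 + \<beta> / 2 * real n)"
        using num den dp np by (intro frac_le) auto
      also have "\<dots> = (real n * (s2 + \<beta> / 4)) / (real n * (s2 + \<beta> / 2))" by (simp add: algebra_simps)
      also have "\<dots> = \<rho>" unfolding \<rho>_def using n by simp
      finally have le: "(2 * b + E + D) / (2 * b + (dd n + 2 * x + E - q)) \<le> \<rho>" .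
      show "(1 + 2 * real n) powr h * ((2 * b + E + D) / (2 * b + (dd n + 2 * x + E - q))) powr (a + real n / 2) \<le> ?r n"
      proof (intro mult_left_mono)
        have "exp (- c * (a + real n / 2)) = \<rho> powr (a + real n / 2)"
          unfolding c_def powr_def using \<rho> by (simp add: mult.commute)
        then show "((2 * b + E + D) / (2 * b + (dd n + 2 * x + E - q))) powr (a + real n / 2) \<le> exp (- c * (a + real n / 2))"
          using le a E0 b D den dp by (auto intro!: powr_mono2 divide_nonneg_nonneg)
      qed simp
    qed
  qed
  with powr_times_exp_neg_tendsto_0[OF h c] show ?thesis by (rule that)
qed

text \<open>Numerator and denominator differ by D + q only, against a denominator of order n. By 1 +
  t <= exp t, the power a + n/2 of the quotient is at most exp (c (D + sqrt (ln n))), which the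
  factor (n/2)^(-1/2) defeats.\<close>

lemma overfitted_ratio_vanishes:
  fixes s2 b D a :: real and k k' :: nat
  assumes s2: "s2 > 0" and b: "b > 0" and a: "a > 0" and D: "D \<ge> 0" and k: "k < k'"
  obtains r where "r \<longlonglongrightarrow> 0"
    "\<forall>\<^sub>F n in sequentially. \<forall>E q. \<bar>E - real n * s2\<bar> \<le> s2 / 2 * real n \<longrightarrow> 0 \<le> q \<longrightarrow> q \<le> sqrt (ln (real n)) \<longrightarrow>
      (real n / 2) powr (- real k' / 2) * (1 + 2 * real n) powr (real k / 2)
        * ((2 * b + E + D) / (2 * b + (E - q))) powr (a + real n / 2) \<le> r n"
proof -
  \<comment> \<open>The exponent is at most (a + 1/2) n, and the denominator is at least s2 n / 4
    (s2 n / 2 from \<open>E\<close>, less s2 n / 4 for \<open>q\<close>); c is the quotient of the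
    two.\<close>
  define c where "c = 4 * (a + 1 / 2) / s2"
  have c: "c > 0" unfolding c_def using s2 a by simp
  let ?L = "\<lambda>n. sqrt (ln (real n))"
  let ?r = "\<lambda>n. 6 powr (real k / 2) * ((real n / 2) powr (- 1 / 2) * exp (c * (D + ?L n)))"
  have r: "?r \<longlonglongrightarrow> 0" using tendsto_mult_right_zero[OF inv_sqrt_times_exp_sqrt_ln_tendsto_0[OF c]] .
  have e2: "\<forall>\<^sub>F n in sequentially. ?L n \<le> s2 / 4 * real n" using s2 by (intro sqrt_ln_le_linear) simp
  have "\<forall>\<^sub>F n in sequentially. \<forall>E q. \<bar>E - real n * s2\<bar> \<le> s2 / 2 * real n \<longrightarrow> 0 \<le> q \<longrightarrow> q \<le> ?L n \<longrightarrow>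
      (real n / 2) powr (- real k' / 2) * (1 + 2 * real n) powr (real k / 2)
        * ((2 * b + E + D) / (2 * b + (E - q))) powr (a + real n / 2) \<le> ?r n"
    using e2 eventually_ge_at_top[of 2]
  proof eventually_elim
    case (elim n)
    have n: "real n \<ge> 2" using elim by simp
    \<comment> \<open>1 + 2n <= 3n = 6 (n/2) brings both powers to the base n/2, which is at least 1
      for n >= 2, so a larger exponent gives a larger power; k < k' makes the exponent at most
      -1/2.\<close>
    have "(1 + 2 * real n) powr (real k / 2) \<le> (6 * (real n / 2)) powr (real k / 2)"
      using n by (intro powr_mono2) auto
    also have "\<dots> = 6 powr (real k / 2) * (real n / 2) powr (real k / 2)" by (rule powr_mult)
    finally have "(real n / 2) powr (- real k' / 2) * (1 + 2 * real n) powr (real k / 2)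
      \<le> (real n / 2) powr (- real k' / 2) * (6 powr (real k / 2) * (real n / 2) powr (real k / 2))"
      by (intro mult_left_mono) auto
    also have "\<dots> = 6 powr (real k / 2) * (real n / 2) powr (- real k' / 2 + real k / 2)"
      unfolding powr_add by simp
    also have "\<dots> \<le> 6 powr (real k / 2) * (real n / 2) powr (- 1 / 2)"
      using n k by (intro mult_left_mono powr_mono) auto
    finally have pre: "(real n / 2) powr (- real k' / 2) * (1 + 2 * real n) powr (real k / 2)
      \<le> 6 powr (real k / 2) * (real n / 2) powr (- 1 / 2)" .
    show ?case
    proof (intro allI impI)
      fix E q :: real
      assume E: "\<bar>E - real n * s2\<bar> \<le> s2 / 2 * real n" and q: "0 \<le> q" "q \<le> ?L n"
      have "s2 / 2 * real n \<le> E" using E by (simp add: algebra_simps abs_if split: if_splits)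
      then have den: "s2 / 4 * real n \<le> 2 * b + (E - q)" using q elim(1) b by simp
      have sp: "0 < s2 / 4 * real n" using s2 n by simp
      then have dp: "0 < 2 * b + (E - q)" using den by linarith
      have "(2 * b + E + D) / (2 * b + (E - q)) = 1 + (D + q) / (2 * b + (E - q))" using dp by (simp add: field_simps)
      also have "\<dots> \<le> 1 + (D + ?L n) / (s2 / 4 * real n)"
        using q D den sp by (intro add_left_mono frac_le) auto
      also have "\<dots> \<le> exp ((D + ?L n) / (s2 / 4 * real n))" by (rule exp_ge_add_one_self)
      finally have le: "(2 * b + E + D) / (2 * b + (E - q)) \<le> exp ((D + ?L n) / (s2 / 4 * real n))" .
      have nn: "0 \<le> (2 * b + E + D) / (2 * b + (E - q))" using dp q D b \<open>s2 / 2 * real n \<le> E\<close> sp by simp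
      have "((2 * b + E + D) / (2 * b + (E - q))) powr (a + real n / 2) \<le> exp ((D + ?L n) / (s2 / 4 * real n)) powr (a + real n / 2)"
        using a le nn by (intro powr_mono2) auto
      also have "\<dots> = exp ((a + real n / 2) * ((D + ?L n) / (s2 / 4 * real n)))" by (simp add: powr_def)
      also have "\<dots> \<le> exp (c * (D + ?L n))"
      proof -
        have "a + real n / 2 \<le> (a + 1 / 2) * real n" using a n by (simp add: algebra_simps)
        then have "(a + real n / 2) * ((D + ?L n) / (s2 / 4 * real n)) \<le> (a + 1 / 2) * real n * ((D + ?L n) / (s2 / 4 * real n))"
          using sp D q by (intro mult_right_mono divide_nonneg_pos) auto
        also have "\<dots> = c * (D + ?L n)" unfolding c_def using n s2 by (simp add: field_simps)
        finally show ?thesis by simp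
      qed
      finally have "((2 * b + E + D) / (2 * b + (E - q))) powr (a + real n / 2) \<le> exp (c * (D + ?L n))" .
      then have "(real n / 2) powr (- real k' / 2) * (1 + 2 * real n) powr (real k / 2)
        * ((2 * b + E + D) / (2 * b + (E - q))) powr (a + real n / 2)
        \<le> 6 powr (real k / 2) * (real n / 2) powr (- 1 / 2) * exp (c * (D + ?L n))"
        by (intro mult_mono pre) auto
      then show "(real n / 2) powr (- real k' / 2) * (1 + 2 * real n) powr (real k / 2)
        * ((2 * b + E + D) / (2 * b + (E - q))) powr (a + real n / 2) \<le> ?r n" by (simp only: mult.assoc)
    qed
  qed
  with r show ?thesis by (rule that)
qed


section \<open>The posterior under the true sampling distribution\<close>

locale selection_setting =
  fixes p :: nat and pw pt :: "nat \<Rightarrow> real" and a b zeta :: real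
    and X :: "nat \<Rightarrow> real mat" and A :: "nat set" and betaA :: "real vec" and s2 :: real
  assumes pw: "\<forall>i<p. 0 \<le> pw i"
    and pt: "\<forall>k\<in>{1..p}. 0 \<le> pt k"
    and ab: "0 < a" "0 < b"
    and design: "\<forall>\<^sub>F n in sequentially. valid_design n p (X n)"
    and A: "A \<in> models p"
    and A_prior: "0 < model_weight pw pt A"
    and beta: "betaA \<in> carrier_vec (card A)"
    and s2: "0 < s2"
    and signal: "\<forall>A'\<in>models p. \<not> A \<subseteq> A' \<longrightarrow>
       (\<exists>bA'>0. (\<lambda>n. (let v = design_cols (X n) A *\<^sub>v betaA in
                         v \<bullet> ((1\<^sub>m n - hat_mat (X n) A') *\<^sub>v v)) / real n) \<longlonglongrightarrow> bA')"
begin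

definition mean :: "nat \<Rightarrow> real vec" where "mean n = design_cols (X n) A *\<^sub>v betaA"

text \<open>|d|^2 in the notation of the overview. \<open>quadratic_form_eq_misfit\<close>
  identifies it with the quadratic form of the signal hypothesis.\<close>

definition misfit :: "nat set \<Rightarrow> nat \<Rightarrow> real" where
  "misfit A' n = full_rank_mat.rss (design_cols (X n) A') (mean n)"

abbreviation "T n \<equiv> true_dist (X n) A betaA s2"

text \<open>The condition 2 <= n makes ln n positive and n/2 at least 1.\<close>

definition regular :: "nat \<Rightarrow> bool" where
  "regular n \<longleftrightarrow> valid_design n p (X n) \<and> zeta < real n \<and> 2 \<le> n"

lemma eventually_regular: "\<forall>\<^sub>F n in sequentially. regular n"
proof -
  have "\<forall>\<^sub>F n in sequentially. zeta < real n" by real_asymp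
  then show ?thesis using design eventually_ge_at_top[of 2] unfolding regular_def by eventually_elim simp
qed

lemma regular_design:
  assumes "regular n" "B \<in> models p"
  shows "regression_design (X n) n p B zeta"
  using assms unfolding regular_def models_def by unfold_locales auto

lemma finite_models: "finite (models p)"
  unfolding models_def by (rule finite_subset[of _ "Pow {..<p}"]) auto

lemma card_model: "B \<in> models p \<Longrightarrow> card B \<in> {1..p}"
  unfolding models_def using card_mono[of "{..<p}" B] finite_subset[of B "{..<p}"]
  by (auto simp: Suc_le_eq card_gt_0_iff)

lemma model_weight_nonneg: "B \<in> models p \<Longrightarrow> 0 \<le> model_weight pw pt B"
  using card_model[of B] pw pt unfolding model_weight_def models_def
  by (intro mult_nonneg_nonneg divide_nonneg_nonneg sum_nonneg) auto

lemma weighted_marginal_nonneg: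
  "B \<in> models p \<Longrightarrow> 0 \<le> model_weight pw pt B * marginal_lik a b zeta (X n) B y"
  using model_weight_nonneg by (simp add: marginal_lik_def)

lemma marginal_pos:
  assumes "regular n" "y \<in> carrier_vec n"
  shows "0 < marginal_lik a b zeta (X n) A y"
  using marginal_lik_pos[OF regular_design[OF assms(1) A] ab assms(2)] assms(1) unfolding regular_def by simp

lemma evidence_ge:
  "model_weight pw pt A * marginal_lik a b zeta (X n) A y
    \<le> (\<Sum>B\<in>models p. model_weight pw pt B * marginal_lik a b zeta (X n) B y)"
  by (rule member_le_sum[OF A _ finite_models]) (use weighted_marginal_nonneg in auto)

lemma post_model_sum:
  assumes "regular n" "y \<in> carrier_vec n"
  shows "(\<Sum>B\<in>models p. post_model p pw pt a b zeta (X n) y B) = 1"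
proof -
  have "0 < (\<Sum>B\<in>models p. model_weight pw pt B * marginal_lik a b zeta (X n) B y)"
    using evidence_ge[of n y] mult_pos_pos[OF A_prior marginal_pos[OF assms]] by linarith
  then show ?thesis unfolding post_model_def sum_divide_distrib[symmetric] by simp
qed

text \<open>All summands of the evidence are nonnegative, so it is at least the summand of the true
  model.\<close>

lemma post_model_le:
  assumes "regular n" "y \<in> carrier_vec n" and A': "A' \<in> models p"
  shows "\<bar>post_model p pw pt a b zeta (X n) y A'\<bar> \<le> model_weight pw pt A' / model_weight pw pt A
    * (marginal_lik a b zeta (X n) A' y / marginal_lik a b zeta (X n) A y)"
proof -
  let ?w = "model_weight pw pt" and ?m = "\<lambda>B. marginal_lik a b zeta (X n) B y"
  have pos: "0 < ?w A * ?m A" using mult_pos_pos[OF A_prior marginal_pos[OF assms(1,2)]] .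
  have "?w A' * ?m A' / (\<Sum>B\<in>models p. ?w B * ?m B) \<le> ?w A' * ?m A' / (?w A * ?m A)"
    using evidence_ge[of n y] weighted_marginal_nonneg[OF A'] pos by (intro frac_le) auto
  moreover have "0 \<le> ?w A' * ?m A' / (\<Sum>B\<in>models p. ?w B * ?m B)"
    using weighted_marginal_nonneg[OF A'] weighted_marginal_nonneg by (intro divide_nonneg_nonneg sum_nonneg) auto
  ultimately show ?thesis unfolding post_model_def by simp
qed

lemma mean_carrier: "regular n \<Longrightarrow> mean n \<in> carrier_vec n"
proof -
  assume "regular n"
  then interpret regression_design "X n" n p A zeta by (rule regular_design[OF _ A])
  show ?thesis unfolding mean_def by (rule mult_vec_carrier[OF beta])
qed

lemma true_dist_eq:
  assumes "regular n"
  shows "T n = gaussian_noise.P n (\<lambda>r. mean n $ r) s2"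
proof -
  interpret gaussian_noise n "\<lambda>r. mean n $ r" s2 by standard (rule s2)
  interpret regression_design "X n" n p A zeta by (rule regular_design[OF assms A])
  show ?thesis unfolding P_def unfolding true_dist_def mean_def dim_row_X ..
qed

lemma prob_space_true_dist: "prob_space (T n)"
  unfolding true_dist_def using s2 by (intro prob_space_PiM prob_space_normal_density) simp

text \<open>No probability is involved: \<open>y\<close> is arbitrary, and its noise enters only
  through \<open>E\<close>, \<open>q\<close> and \<open>x\<close>. \<open>D\<close> bounds the
  explained sum of squares over 1 + n, by |mu + e|^2 <= 2 |mu|^2 + 2 |e|^2 and the linear growth of
  |mu|^2. The second claim removes the cross term for nested models.\<close>

lemma posterior_ratio_bound:
  assumes reg: "regular n" and A': "A' \<in> models p"
    and E: "(\<Sum>i<n. (y i - mean n $ i)\<^sup>2) = E" "E \<le> C * real n"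
    and q: "(\<Sum>r<n. (\<Sum>i<n. col_proj (design_cols (X n) A') $$ (r, i) * (y i - mean n $ i))\<^sup>2) = q"
    and x: "(\<Sum>i<n. (mean n - col_proj (design_cols (X n) A') *\<^sub>v mean n) $ i * (y i - mean n $ i)) = x"
    and D: "D = 2 * real (card A) * (betaA \<bullet> betaA) + 2 * C"
  shows "\<bar>post_model p pw pt a b zeta (X n) (vec n y) A'\<bar>
    \<le> model_weight pw pt A' / model_weight pw pt A * ratio_const (card A')
      * ((real n / 2) powr (- real (card A') / 2) * (1 + 2 * real n) powr (real (card A) / 2)
      * ((2 * b + E + D) / (2 * b + (misfit A' n + 2 * x + E - q))) powr (a + real n / 2))"
    and "misfit A' n = 0 \<Longrightarrow> x = 0"
proof -
  interpret A: regression_design "X n" n p A zeta by (rule regular_design[OF reg A])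
  interpret A': regression_design "X n" n p A' zeta by (rule regular_design[OF reg A'])
  have n: "n \<ge> 2" using reg unfolding regular_def by simp
  let ?m = "mean n"
  define e where "e = vec n (\<lambda>i. y i - ?m $ i)"
  let ?d = "?m - col_proj (design_cols (X n) A') *\<^sub>v ?m"
  have m: "?m \<in> carrier_vec n" by (rule mean_carrier[OF reg])
  have e: "e \<in> carrier_vec n" unfolding e_def by simp
  have d: "?d \<in> carrier_vec n" using m by simp
  have y: "vec n y \<in> carrier_vec n" by simp
  have ye: "vec n y = ?m + e" unfolding e_def using m by (intro eq_vecI) auto
  have ee: "e \<bullet> e = E" using E(1) unfolding scalar_prod_self_sum by (simp add: e_def)
  have de: "?d \<bullet> e = x"
    using x e by (simp add: scalar_prod_def atLeast0LessThan e_def)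
  have dP: "dim_row (col_proj (design_cols (X n) A')) = n" "dim_col (col_proj (design_cols (X n) A')) = n"
    using carrier_matD[OF A'.col_proj_carrier] by auto
  have qe: "A'.ess e = q"
    unfolding A'.ess_def scalar_prod_self_sum q[symmetric] using dP
    by (auto simp: scalar_prod_def atLeast0LessThan e_def intro!: sum.cong)
  have dd: "?d \<bullet> ?d = misfit A' n" unfolding misfit_def A'.rss_def ..
  have R': "A'.rss (vec n y) = misfit A' n + 2 * x + E - q"
    using A'.rss_add[OF m e] unfolding ye dd de ee qe by simp
  show "misfit A' n = 0 \<Longrightarrow> x = 0"
    using scalar_prod_self_eq_0[OF d] dd de e by simp
  \<comment> \<open>The true mean lies in the column space of the true model, so the residual there
    is that of the noise alone and is at most \<open>E\<close>.\<close>
  have "?m - col_proj (design_cols (X n) A) *\<^sub>v ?m = 0\<^sub>v n"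
    using A.col_proj_fix[OF beta] m unfolding mean_def by simp
  then have "A.rss (vec n y) = E - A.ess e"
    using A.rss_add[OF m e] e unfolding ye ee by simp
  then have R: "A.rss (vec n y) \<le> E" using A.ess_nonneg[of e] by simp
  have "A.ess (vec n y) \<le> vec n y \<bullet> vec n y"
    using A.rss_eq[OF y] A.rss_nonneg[of "vec n y"] by simp
  also have "\<dots> = (\<Sum>i<n. (?m $ i + e $ i)\<^sup>2)" unfolding ye scalar_prod_self_sum using e by simp
  also have "\<dots> \<le> (\<Sum>i<n. 2 * (?m $ i)\<^sup>2 + 2 * (e $ i)\<^sup>2)"
  proof (rule sum_mono)
    fix i
    have "0 \<le> (?m $ i - e $ i)\<^sup>2" by simp
    then show "(?m $ i + e $ i)\<^sup>2 \<le> 2 * (?m $ i)\<^sup>2 + 2 * (e $ i)\<^sup>2"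
      by (simp add: power2_eq_square algebra_simps)
  qed
  also have "\<dots> = 2 * (?m \<bullet> ?m) + 2 * E"
    unfolding ee[symmetric] scalar_prod_self_sum using m e by (simp add: sum.distrib sum_distrib_left)
  also have "?m \<bullet> ?m \<le> real (card A) * (betaA \<bullet> betaA) * real n"
    using valid_design_mean_bound[OF A.valid A.A_sub beta] unfolding mean_def .
  finally have "A.ess (vec n y) \<le> D * real n" using E(2) unfolding D by (simp add: algebra_simps)
  also have "\<dots> \<le> D * (1 + real n)"
  proof -
    have "0 \<le> E" unfolding E(1)[symmetric] by (rule sum_nonneg) simp
    then have "0 \<le> C * real n" using E(2) by linarith
    then have "0 \<le> C" using n by (simp add: zero_le_mult_iff)
    then have "0 \<le> D" unfolding D by (simp add: scalar_prod_self_nonneg)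
    then show ?thesis by (simp add: algebra_simps)
  qed
  finally have S: "A.ess (vec n y) / (1 + real n) \<le> D" by (simp add: field_simps)
  have w: "0 \<le> model_weight pw pt A' / model_weight pw pt A"
    using model_weight_nonneg[OF A'] A_prior by simp
  have den: "0 < 2 * b + A'.rss (vec n y)" using ab A'.rss_nonneg[of "vec n y"] by simp
  have "\<bar>post_model p pw pt a b zeta (X n) (vec n y) A'\<bar> \<le> model_weight pw pt A' / model_weight pw pt A
    * (marginal_lik a b zeta (X n) A' (vec n y) / marginal_lik a b zeta (X n) A (vec n y))"
    by (rule post_model_le[OF reg y A'])
  also have "\<dots> \<le> model_weight pw pt A' / model_weight pw pt A
    * (ratio_const (card A') * (real n / 2) powr (- real (card A') / 2) * (1 + 2 * real n) powr (real (card A) / 2)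
      * ((2 * b + A.rss (vec n y) + A.ess (vec n y) / (1 + real n)) / (2 * b + A'.rss (vec n y))) powr (a + real n / 2))"
    using n by (intro mult_left_mono[OF _ w] marginal_lik_ratio_le[OF regular_design[OF reg A] regular_design[OF reg A'] ab y]) auto
  also have "\<dots> \<le> model_weight pw pt A' / model_weight pw pt A
    * (ratio_const (card A') * (real n / 2) powr (- real (card A') / 2) * (1 + 2 * real n) powr (real (card A) / 2)
      * ((2 * b + E + D) / (2 * b + A'.rss (vec n y))) powr (a + real n / 2))"
  proof (intro mult_left_mono[OF _ w] mult_left_mono powr_mono2 divide_right_mono)
    show "0 \<le> (2 * b + A.rss (vec n y) + A.ess (vec n y) / (1 + real n)) / (2 * b + A'.rss (vec n y))"
      using ab A.rss_nonneg[of "vec n y"] A.ess_nonneg[of "vec n y"] den by simp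
  qed (use R S ab den ratio_const_pos[of "card A'"] in auto)
  finally show "\<bar>post_model p pw pt a b zeta (X n) (vec n y) A'\<bar>
    \<le> model_weight pw pt A' / model_weight pw pt A * ratio_const (card A')
      * ((real n / 2) powr (- real (card A') / 2) * (1 + 2 * real n) powr (real (card A) / 2)
      * ((2 * b + E + D) / (2 * b + (misfit A' n + 2 * x + E - q))) powr (a + real n / 2))"
    unfolding R' by (simp only: mult.assoc)
qed

definition noise_sq :: "nat \<Rightarrow> (nat \<Rightarrow> real) \<Rightarrow> real" where
  "noise_sq n y = (\<Sum>i<n. (y i - mean n $ i)\<^sup>2)"

text \<open>|P' e|^2 for the noise e = y - mu, written entrywise so that
  \<open>markov_projected\<close> applies; \<open>cross_noise\<close> is d.e in the form required by
  \<open>chebyshev_linear\<close>.\<close>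

definition fitted_noise :: "nat set \<Rightarrow> nat \<Rightarrow> (nat \<Rightarrow> real) \<Rightarrow> real" where
  "fitted_noise A' n y = (\<Sum>r<n. (\<Sum>i<n. col_proj (design_cols (X n) A') $$ (r, i) * (y i - mean n $ i))\<^sup>2)"

definition cross_noise :: "nat set \<Rightarrow> nat \<Rightarrow> (nat \<Rightarrow> real) \<Rightarrow> real" where
  "cross_noise A' n y = (\<Sum>i<n. (mean n - col_proj (design_cols (X n) A') *\<^sub>v mean n) $ i * (y i - mean n $ i))"

(* Off this event all three random quantities entering the bound on the posterior are controlled; the slowly
   growing threshold sqrt (ln n) makes the second part negligible while exp (c * sqrt (ln n)) stays o(sqrt n). *)
definition bad :: "real \<Rightarrow> nat set \<Rightarrow> nat \<Rightarrow> (nat \<Rightarrow> real) set" where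
  "bad \<delta> A' n = {y \<in> space (T n). \<delta> * real n \<le> \<bar>noise_sq n y - real n * s2\<bar>}
    \<union> {y \<in> space (T n). sqrt (ln (real n)) \<le> fitted_noise A' n y}
    \<union> {y \<in> space (T n). \<delta> * real n \<le> \<bar>cross_noise A' n y\<bar>}"

text \<open>The three summands are Chebyshev for |e|^2 with variance 2 s2^2 n, Markov for |P' e|^2
  with mean s2 k', and Chebyshev for d.e with variance s2 |d|^2.\<close>

lemma bad_sets_measure:
  assumes reg: "regular n" and A': "A' \<in> models p" and \<delta>: "\<delta> > 0"
  shows "bad \<delta> A' n \<in> sets (T n)"
    and "measure (T n) (bad \<delta> A' n) \<le> 2 * s2\<^sup>2 / \<delta>\<^sup>2 / real n + s2 * real (card A') / sqrt (ln (real n))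
      + s2 / \<delta>\<^sup>2 * (misfit A' n / real n) / real n"
proof -
  interpret gaussian_noise n "\<lambda>r. mean n $ r" s2 by standard (rule s2)
  interpret A': regression_design "X n" n p A' zeta by (rule regular_design[OF reg A'])
  note T = true_dist_eq[OF reg]
  have n: "n \<ge> 2" using reg unfolding regular_def by simp
  let ?d = "mean n - col_proj (design_cols (X n) A') *\<^sub>v mean n"
  have dd: "(\<Sum>i<n. (?d $ i)\<^sup>2) = misfit A' n"
    unfolding misfit_def A'.rss_def scalar_prod_self_sum using mean_carrier[OF reg] carrier_matD[OF A'.col_proj_carrier] by simp
  let ?B1 = "{y \<in> space P. \<delta> * real n \<le> \<bar>(\<Sum>i<n. (y i - mean n $ i)\<^sup>2) - real n * s2\<bar>}"
  let ?B2 = "{y \<in> space P. sqrt (ln (real n)) \<le> (\<Sum>r<n. (\<Sum>i<n. col_proj (design_cols (X n) A') $$ (r, i) * (y i - mean n $ i))\<^sup>2)}"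
  let ?B3 = "{y \<in> space P. \<delta> * real n \<le> \<bar>\<Sum>i<n. ?d $ i * (y i - mean n $ i)\<bar>}"
  have bad: "bad \<delta> A' n = ?B1 \<union> ?B2 \<union> ?B3"
    unfolding bad_def T noise_sq_def fitted_noise_def cross_noise_def ..
  have m1: "?B1 \<in> sets P" by measurable
  have m2: "?B2 \<in> sets P" by measurable
  have m3: "?B3 \<in> sets P" by measurable
  show "bad \<delta> A' n \<in> sets (T n)" unfolding bad T using m1 m2 m3 by auto
  have "measure P ?B1 \<le> 2 * s2\<^sup>2 / \<delta>\<^sup>2 / real n" using chebyshev_square[OF \<delta>] n by simp
  moreover have "measure P ?B2 \<le> s2 * real (card A') / sqrt (ln (real n))"
    using markov_projected[of "sqrt (ln (real n))" "\<lambda>r i. col_proj (design_cols (X n) A') $$ (r, i)"] n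
    unfolding A'.col_proj_entries_sq_sum by simp
  moreover have "measure P ?B3 \<le> s2 * misfit A' n / (\<delta> * real n)\<^sup>2"
    using chebyshev_linear[of "\<delta> * real n" "\<lambda>i. ?d $ i"] \<delta> n unfolding dd by simp
  moreover have "s2 * misfit A' n / (\<delta> * real n)\<^sup>2 = s2 / \<delta>\<^sup>2 * (misfit A' n / real n) / real n"
    using \<delta> n by (simp add: power2_eq_square)
  moreover have "measure P (?B1 \<union> ?B2 \<union> ?B3) \<le> measure P ?B1 + measure P ?B2 + measure P ?B3"
    using measure_Un_le[of "?B1 \<union> ?B2" P ?B3] measure_Un_le[OF m1 m2] m1 m2 m3 by auto
  ultimately show "measure (T n) (bad \<delta> A' n) \<le> 2 * s2\<^sup>2 / \<delta>\<^sup>2 / real n + s2 * real (card A') / sqrt (ln (real n))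
      + s2 / \<delta>\<^sup>2 * (misfit A' n / real n) / real n"
    unfolding bad T by linarith
qed

lemma bad_vanishes:
  assumes A': "A' \<in> models p" and \<delta>: "\<delta> > 0" and lim: "(\<lambda>n. misfit A' n / real n) \<longlonglongrightarrow> \<beta>"
  shows "(\<lambda>n. measure (T n) (bad \<delta> A' n)) \<longlonglongrightarrow> 0"
proof (rule tendsto_sandwich[OF _ _ tendsto_const])
  show "\<forall>\<^sub>F n in sequentially. measure (T n) (bad \<delta> A' n) \<le> 2 * s2\<^sup>2 / \<delta>\<^sup>2 / real n + s2 * real (card A') / sqrt (ln (real n))
      + s2 / \<delta>\<^sup>2 * (misfit A' n / real n) / real n"
    using eventually_regular by eventually_elim (rule bad_sets_measure(2)[OF _ A' \<delta>])
  have 1: "(\<lambda>n. 2 * s2\<^sup>2 / \<delta>\<^sup>2 / real n) \<longlonglongrightarrow> 0" by (rule lim_const_over_n)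
  have 2: "(\<lambda>n. s2 * real (card A') / sqrt (ln (real n))) \<longlonglongrightarrow> 0" by (rule inverse_sqrt_ln_tendsto_0)
  have 3: "(\<lambda>n. s2 / \<delta>\<^sup>2 * (misfit A' n / real n) / real n) \<longlonglongrightarrow> 0"
    using tendsto_mult[OF tendsto_mult[OF tendsto_const lim, of "s2 / \<delta>\<^sup>2"] lim_const_over_n[of 1]] by simp
  show "(\<lambda>n. 2 * s2\<^sup>2 / \<delta>\<^sup>2 / real n + s2 * real (card A') / sqrt (ln (real n))
      + s2 / \<delta>\<^sup>2 * (misfit A' n / real n) / real n) \<longlonglongrightarrow> 0"
    using tendsto_add[OF tendsto_add[OF 1 2] 3] by simp
qed simp

text \<open>Reduces convergence in probability to a deterministic bound on the good event, with one
  set of premises for both kinds of wrong model: the implication from zero misfit to x = 0 serves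
  the nested case, the limit \<beta> may be 0 or positive.\<close>

lemma posterior_vanishesI:
  assumes A': "A' \<in> models p" and \<delta>: "\<delta> > 0" and lim: "(\<lambda>n. misfit A' n / real n) \<longlonglongrightarrow> \<beta>"
    and D: "D = 2 * real (card A) * (betaA \<bullet> betaA) + 2 * (s2 + \<delta>)"
    and r: "r \<longlonglongrightarrow> 0"
    and bound: "\<forall>\<^sub>F n in sequentially. \<forall>E q x. 0 \<le> E \<longrightarrow> \<bar>E - real n * s2\<bar> \<le> \<delta> * real n \<longrightarrow> 0 \<le> q \<longrightarrow> q \<le> sqrt (ln (real n)) \<longrightarrow>
      \<bar>x\<bar> \<le> \<delta> * real n \<longrightarrow> (misfit A' n = 0 \<longrightarrow> x = 0) \<longrightarrow>
      (real n / 2) powr (- real (card A') / 2) * (1 + 2 * real n) powr (real (card A) / 2)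
      * ((2 * b + E + D) / (2 * b + (misfit A' n + 2 * x + E - q))) powr (a + real n / 2) \<le> r n"
  shows "conv_in_prob T (\<lambda>n y. post_model p pw pt a b zeta (X n) (vec n y) A') 0"
proof (rule conv_in_prob_zeroI)
  let ?K = "model_weight pw pt A' / model_weight pw pt A * ratio_const (card A')"
  have K: "0 \<le> ?K" using model_weight_nonneg[OF A'] A_prior ratio_const_pos[of "card A'"]
    by (intro mult_nonneg_nonneg divide_nonneg_nonneg) auto
  show "(\<lambda>n. ?K * r n) \<longlonglongrightarrow> 0" using tendsto_mult_right_zero[OF r] .
  show "(\<lambda>n. measure (T n) (bad \<delta> A' n)) \<longlonglongrightarrow> 0" by (rule bad_vanishes[OF A' \<delta> lim])
  show "\<forall>\<^sub>F n in sequentially. bad \<delta> A' n \<in> sets (T n) \<and>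
      (\<forall>y\<in>space (T n) - bad \<delta> A' n. \<bar>post_model p pw pt a b zeta (X n) (vec n y) A'\<bar> \<le> ?K * r n)"
    using eventually_regular bound
  proof eventually_elim
    case (elim n)
    show ?case
    proof (intro conjI ballI)
      show "bad \<delta> A' n \<in> sets (T n)" by (rule bad_sets_measure(1)[OF elim(1) A' \<delta>])
      fix y assume "y \<in> space (T n) - bad \<delta> A' n"
      then have E: "\<bar>noise_sq n y - real n * s2\<bar> \<le> \<delta> * real n"
        and q: "fitted_noise A' n y \<le> sqrt (ln (real n))"
        and x: "\<bar>cross_noise A' n y\<bar> \<le> \<delta> * real n"
        unfolding bad_def by auto
      have E0: "0 \<le> noise_sq n y" and q0: "0 \<le> fitted_noise A' n y"
        unfolding noise_sq_def fitted_noise_def by (auto intro!: sum_nonneg)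
      \<comment> \<open>Fixes C = s2 + \<delta>, the value built into \<open>D\<close>.\<close>
      have EC: "noise_sq n y \<le> (s2 + \<delta>) * real n" using E by (simp add: algebra_simps)
      note * = posterior_ratio_bound[OF elim(1) A' noise_sq_def[symmetric] EC fitted_noise_def[symmetric]
          cross_noise_def[symmetric] D]
      note *(1)
      also have "?K * ((real n / 2) powr (- real (card A') / 2) * (1 + 2 * real n) powr (real (card A) / 2)
          * ((2 * b + noise_sq n y + D) / (2 * b + (misfit A' n + 2 * cross_noise A' n y + noise_sq n y - fitted_noise A' n y))) powr (a + real n / 2))
        \<le> ?K * r n"
        using elim(2) E0 E q0 q x *(2) by (intro mult_left_mono[OF _ K]) auto
      finally show "\<bar>post_model p pw pt a b zeta (X n) (vec n y) A'\<bar> \<le> ?K * r n" .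
    qed
  qed
qed

lemma quadratic_form_eq_misfit:
  assumes reg: "regular n" and A': "A' \<in> models p"
  shows "mean n \<bullet> ((1\<^sub>m n - hat_mat (X n) A') *\<^sub>v mean n) = misfit A' n"
proof -
  interpret A': regression_design "X n" n p A' zeta by (rule regular_design[OF reg A'])
  have m: "mean n \<in> carrier_vec n" by (rule mean_carrier[OF reg])
  have "(1\<^sub>m n - col_proj (design_cols (X n) A')) *\<^sub>v mean n = mean n - col_proj (design_cols (X n) A') *\<^sub>v mean n"
    using minus_mult_distrib_mat_vec[OF one_carrier_mat A'.col_proj_carrier m] m by simp
  then show ?thesis
    unfolding misfit_def hat_mat_eq_col_proj A'.rss_eq[OF m] A'.ess_eq[OF m]
    using scalar_prod_minus_distrib[OF m m A'.col_proj_vec_carrier[OF m]] by simp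
qed

lemma posterior_vanishes:
  assumes A': "A' \<in> models p" and ne: "A' \<noteq> A"
  shows "conv_in_prob T (\<lambda>n y. post_model p pw pt a b zeta (X n) (vec n y) A') 0"
proof (cases "A \<subseteq> A'")
  case False
  then obtain \<beta> where \<beta>: "\<beta> > 0"
    and lim': "(\<lambda>n. (let v = design_cols (X n) A *\<^sub>v betaA in v \<bullet> ((1\<^sub>m n - hat_mat (X n) A') *\<^sub>v v)) / real n) \<longlonglongrightarrow> \<beta>"
    using signal A' by blast
  have lim: "(\<lambda>n. misfit A' n / real n) \<longlonglongrightarrow> \<beta>"
  proof (rule Lim_transform_eventually[OF lim'])
    show "\<forall>\<^sub>F n in sequentially. (let v = design_cols (X n) A *\<^sub>v betaA in v \<bullet> ((1\<^sub>m n - hat_mat (X n) A') *\<^sub>v v)) / real n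
      = misfit A' n / real n"
      using eventually_regular
      by eventually_elim (use quadratic_form_eq_misfit[OF _ A'] in \<open>simp add: Let_def mean_def\<close>)
  qed
  define D where "D = 2 * real (card A) * (betaA \<bullet> betaA) + 2 * (s2 + \<beta> / 8)"
  have D: "D \<ge> 0" unfolding D_def using s2 \<beta> by (simp add: scalar_prod_self_nonneg)
  have h: "real (card A) / 2 > 0" using card_model[OF A] by simp
  obtain r where r: "r \<longlonglongrightarrow> 0" and
    b1: "\<forall>\<^sub>F n in sequentially. \<forall>E q x. 0 \<le> E \<longrightarrow> \<bar>E - real n * s2\<bar> \<le> \<beta> / 8 * real n \<longrightarrow> q \<le> sqrt (ln (real n)) \<longrightarrow> \<bar>x\<bar> \<le> \<beta> / 8 * real n \<longrightarrow>
      (1 + 2 * real n) powr (real (card A) / 2) * ((2 * b + E + D) / (2 * b + (misfit A' n + 2 * x + E - q))) powr (a + real n / 2) \<le> r n"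
    using misspecified_ratio_vanishes[OF s2 \<beta> ab(2) h ab(1) D lim] .
  show ?thesis
  proof (rule posterior_vanishesI[OF A' _ lim D_def r])
    show "\<forall>\<^sub>F n in sequentially. \<forall>E q x. 0 \<le> E \<longrightarrow> \<bar>E - real n * s2\<bar> \<le> \<beta> / 8 * real n \<longrightarrow> 0 \<le> q \<longrightarrow> q \<le> sqrt (ln (real n)) \<longrightarrow>
      \<bar>x\<bar> \<le> \<beta> / 8 * real n \<longrightarrow> (misfit A' n = 0 \<longrightarrow> x = 0) \<longrightarrow>
      (real n / 2) powr (- real (card A') / 2) * (1 + 2 * real n) powr (real (card A) / 2)
      * ((2 * b + E + D) / (2 * b + (misfit A' n + 2 * x + E - q))) powr (a + real n / 2) \<le> r n"
      using b1 eventually_ge_at_top[of 2]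
    proof eventually_elim
      case (elim n)
      \<comment> \<open>The dimension penalty of the wrong model is simply discarded; the
        exponential decay suffices whatever its size.\<close>
      have "(real n / 2) powr (- real (card A') / 2) \<le> 1"
        using elim(2) powr_mono[of "- real (card A') / 2" 0 "real n / 2"] by simp
      then have "(real n / 2) powr (- real (card A') / 2) * u * v \<le> u * v" if "0 \<le> u" "0 \<le> v" for u v
        using that by (simp add: mult_left_le_one_le mult.assoc)
      then show ?case using elim(1) by (meson order_trans powr_ge_zero)
    qed
  qed (use \<beta> in simp)
next
  case True
  have fin: "finite A'" "A' \<subseteq> {..<p}" using A' finite_subset unfolding models_def by auto
  have k: "card A < card A'" using True ne fin by (intro psubset_card_mono) auto
  have z: "misfit A' n = 0" if reg: "regular n" for n
  proof -
    interpret A': regression_design "X n" n p A' zeta by (rule regular_design[OF reg A'])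
    have X: "X n \<in> carrier_mat n p" using A'.valid unfolding valid_design_def by simp
    obtain w where w: "w \<in> carrier_vec (card A')" "mean n = design_cols (X n) A' *\<^sub>v w"
      unfolding mean_def using design_cols_range_mono[OF X True fin(2) beta] .
    \<comment> \<open>A nesting model reproduces the true mean exactly, so the misfit and with it
      the cross term disappear and the bound takes the form of
      \<open>overfitted_ratio_vanishes\<close>.\<close>
    have "mean n - col_proj (design_cols (X n) A') *\<^sub>v mean n = 0\<^sub>v n"
      using A'.col_proj_fix[OF w(1)] w mean_carrier[OF reg] by simp
    then show ?thesis unfolding misfit_def A'.rss_def by simp
  qed
  have lim: "(\<lambda>n. misfit A' n / real n) \<longlonglongrightarrow> 0"
    by (rule tendsto_eventually) (use eventually_regular in eventually_elim, simp add: z)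
  define D where "D = 2 * real (card A) * (betaA \<bullet> betaA) + 2 * (s2 + s2 / 2)"
  have D: "D \<ge> 0" unfolding D_def using s2 by (simp add: scalar_prod_self_nonneg)
  obtain r where r: "r \<longlonglongrightarrow> 0" and
    b2: "\<forall>\<^sub>F n in sequentially. \<forall>E q. \<bar>E - real n * s2\<bar> \<le> s2 / 2 * real n \<longrightarrow> 0 \<le> q \<longrightarrow> q \<le> sqrt (ln (real n)) \<longrightarrow>
      (real n / 2) powr (- real (card A') / 2) * (1 + 2 * real n) powr (real (card A) / 2)
        * ((2 * b + E + D) / (2 * b + (E - q))) powr (a + real n / 2) \<le> r n"
    using overfitted_ratio_vanishes[OF s2 ab(2) ab(1) D k] .
  show ?thesis
  proof (rule posterior_vanishesI[OF A' _ lim D_def r])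
    show "\<forall>\<^sub>F n in sequentially. \<forall>E q x. 0 \<le> E \<longrightarrow> \<bar>E - real n * s2\<bar> \<le> s2 / 2 * real n \<longrightarrow> 0 \<le> q \<longrightarrow> q \<le> sqrt (ln (real n)) \<longrightarrow>
      \<bar>x\<bar> \<le> s2 / 2 * real n \<longrightarrow> (misfit A' n = 0 \<longrightarrow> x = 0) \<longrightarrow>
      (real n / 2) powr (- real (card A') / 2) * (1 + 2 * real n) powr (real (card A) / 2)
      * ((2 * b + E + D) / (2 * b + (misfit A' n + 2 * x + E - q))) powr (a + real n / 2) \<le> r n"
      using b2 eventually_regular by eventually_elim (simp add: z)
  qed (use s2 in simp)
qed

text \<open>The probabilities sum to 1, so the deviation from 1 is the sum over the finitely many
  wrong models.\<close>

lemma posterior_true_model: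
  "conv_in_prob T (\<lambda>n y. post_model p pw pt a b zeta (X n) (vec n y) A) 1"
proof (rule conv_in_prob_dominated)
  show "conv_in_prob T (\<lambda>n y. \<Sum>B\<in>models p - {A}. post_model p pw pt a b zeta (X n) (vec n y) B) 0"
    using finite_models posterior_vanishes by (intro conv_in_prob_sum prob_space_true_dist) auto
  show "\<forall>\<^sub>F n in sequentially. \<forall>y\<in>space (T n). \<bar>post_model p pw pt a b zeta (X n) (vec n y) A - 1\<bar>
    \<le> \<bar>\<Sum>B\<in>models p - {A}. post_model p pw pt a b zeta (X n) (vec n y) B\<bar>"
    using eventually_regular
  proof eventually_elim
    case (elim n)
    show ?case
    proof
      fix y
      show "\<bar>post_model p pw pt a b zeta (X n) (vec n y) A - 1\<bar>
        \<le> \<bar>\<Sum>B\<in>models p - {A}. post_model p pw pt a b zeta (X n) (vec n y) B\<bar>"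
        using post_model_sum[OF elim, of "vec n y"]
          sum.remove[OF finite_models A, of "post_model p pw pt a b zeta (X n) (vec n y)"] by simp
    qed
  qed
qed

end

theorem theorem1:
  fixes p :: nat and pw pt :: "nat \<Rightarrow> real" and a b zeta :: real
    and X :: "nat \<Rightarrow> real mat" and A :: "nat set" and betaA :: "real vec" and s2 :: real
  assumes pw: "\<forall>i<p. 0 \<le> pw i" "(\<Sum>i<p. pw i) = 1"
    and pt: "\<forall>k\<in>{1..p}. 0 \<le> pt k"
    and ab: "0 < a" "0 < b"
    and design: "\<forall>\<^sub>F n in sequentially. valid_design n p (X n)"
    and A: "A \<in> models p"
    and A_prior: "0 < model_weight pw pt A"
    and beta: "betaA \<in> carrier_vec (card A)"
    and s2: "0 < s2"
    and signal: "\<forall>A'\<in>models p. \<not> A \<subseteq> A' \<longrightarrow>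
       (\<exists>bA'>0. (\<lambda>n. (let v = design_cols (X n) A *\<^sub>v betaA in
                         v \<bullet> ((1\<^sub>m n - hat_mat (X n) A') *\<^sub>v v)) / real n) \<longlonglongrightarrow> bA')"
  shows "conv_in_prob (\<lambda>n. true_dist (X n) A betaA s2)
           (\<lambda>n y. post_model p pw pt a b zeta (X n) (vec n y) A) 1
       \<and> (\<forall>A'\<in>models p. A' \<noteq> A \<longrightarrow>
            conv_in_prob (\<lambda>n. true_dist (X n) A betaA s2)
              (\<lambda>n y. post_model p pw pt a b zeta (X n) (vec n y) A') 0)"
proof -
  interpret selection_setting p pw pt a b zeta X A betaA s2
    by unfold_locales (rule pw(1) pt ab design A A_prior beta s2 signal)+
  show ?thesis using posterior_true_model posterior_vanishes by blast
qed

end
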